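(* Let $r\in(0,\infty)$. For any dimension $n\ge 10$ and for any $\theta_n\in\mathbb{R}^n$, $$\rho\big(\theta_n,g[\widehat\theta_n^{JS}]\big)-\rho_0\big(\theta_n,\widehat\theta_n^{JS}\big)\le \tfrac12\Big(a_n^{1/2}b_n^{1/2}r^{-3/2}+(a_n+b_n+l_n)r^{-2}+a_nr^{-3}\Big),$$ where $$a_n=3\big(1-(n-2)^{-1}\big)^{-2},\quad b_n=4\big(2+a_n+k_2(n)\big),\quad l_n=3(1-2/n)^{-2},$$ $$k_2(n)=\max\{e_n,f_n\},\quad e_n=\sqrt3\,\Big\{\prod_{i=1}^4\big(1-(2i+1)/n\big)\Big\}^{-1/2},\quad f_n=\big(1-(\log n/n)^{1/2}\big)^{-2}.$$ Also, $$\Big|\rho\big(\theta_n,g[\widehat\theta_n^{JS}]\big)-\frac n2\log \mathrm{IF}_{\theta_n}(\widehat\theta_n^{JS})\Big|\le\tfrac12\Big(a_n^{1/2}b_n^{1/2}r^{-3/2}+(a_n+b_n)r^{-2}+a_nr^{-3}\Big).$$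
   Context: The observed past is $X_n\sim N(\theta_n,I_n)$ and the future is $Y_n\sim N(\theta_n,rI_n)$, independent of $X_n$ (past variance $1$, future variance $r$). A predictive density estimate $\widehat p(\cdot|X_n)$ has Kullback-Leibler predictive risk $\rho(\theta_n,\widehat p)=\mathbb{E}_{\theta_n}\int p_{\theta_n}(y)\log\frac{p_{\theta_n}(y)}{\widehat p(y|X_n)}\,dy$, where $p_{\theta_n}$ is the $N(\theta_n,rI_n)$ density and $\mathbb{E}_{\theta_n}$ is over $X_n\sim N(\theta_n,I_n)$. For $\mu\in\mathbb{R}^n$, $c>0$, $g[\mu,c]$ is the density of $N(\mu,c\,r\,I_n)$. For a location estimate $\widehat\theta_n=\widehat\theta_n(X_n)$: $q(\theta_n,\widehat\theta_n)=\mathbb{E}_{\theta_n}\|\widehat\theta_n-\theta_n\|^2$; $\rho_0(\theta_n,\widehat\theta_n)=\inf_{\widehat c(X_n)>0}\rho(\theta_n,g[\widehat\theta_n,\widehat c(X_n)])$, the infimum over all positive scale estimates based on $X_n$; and the ideal flattening coefficient is $\mathrm{IF}_{\theta_n}(\widehat\theta_n)=1+(nr)^{-1}q(\theta_n,\widehat\theta_n)$. The James-Stein estimator is $\widehat\theta_n^{JS}=X_n\big(1-\frac{n-2}{\|X_n\|^2}\big)$. Its predictive density estimate is $g[\widehat\theta_n^{JS}]=g[\widehat\theta_n^{JS},\widehat c_n^{JS+}]$ with $\widehat c_n^{JS+}=1+(nr)^{-1}\widehat U_n^{+}$, where $\widehat U_n^{+}=\max\big\{n-\frac{(n-2)^2}{\|X_n\|^2},0\big\}$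 is the positive part of the unbiased estimate of the quadratic risk of $\widehat\theta^{JS}_n$. *)

theory Defs
  imports "HOL-Probability.Probability"
begin

(* Integral with values in the extended reals.  In contrast to the Bochner integral, which is 0 on
   non-integrable functions, it records divergence, so that an infinite risk is not counted as
   a risk of 0 when infima are taken.  The ambiguous case of two infinite parts does not arise for
   the divergence of probability densities: the integral of the negative part is finite there. *)
definition ext_integral :: "'a measure \<Rightarrow> ('a \<Rightarrow> ereal) \<Rightarrow> ereal" where
  "ext_integral M f =
     enn2ereal (\<integral>\<^sup>+x. e2ennreal (f x) \<partial>M) - enn2ereal (\<integral>\<^sup>+x. e2ennreal (- f x) \<partial>M)"

(* v is the variance, whereas normal_density takes the standard deviation. *)
definition gauss_density :: "real ^ 'n \<Rightarrow> real \<Rightarrow> real ^ 'n \<Rightarrow> real" where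
  "gauss_density m v x = (\<Prod>i\<in>UNIV. normal_density (m $ i) (sqrt v) (x $ i))"

definition gauss :: "real ^ 'n \<Rightarrow> real \<Rightarrow> (real ^ 'n) measure" where
  "gauss m v = density lborel (\<lambda>x. ennreal (gauss_density m v x))"

(* The usual conventions 0 log (0 / q) = 0 and p log (p / 0) = \<infinity> for p > 0. *)
definition KL_density :: "(real ^ 'n \<Rightarrow> real) \<Rightarrow> (real ^ 'n \<Rightarrow> real) \<Rightarrow> ereal" where
  "KL_density p q = ext_integral lborel
     (\<lambda>y. if p y = 0 then 0 else if q y = 0 then \<infinity> else ereal (p y * ln (p y / q y)))"

definition pred_risk ::
    "real \<Rightarrow> real ^ 'n \<Rightarrow> (real ^ 'n \<Rightarrow> real ^ 'n \<Rightarrow> real) \<Rightarrow> ereal" where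
  "pred_risk r \<theta> phat =
     ext_integral (gauss \<theta> 1) (\<lambda>x. KL_density (gauss_density \<theta> r) (phat x))"

definition g_est ::
    "real \<Rightarrow> (real ^ 'n \<Rightarrow> real ^ 'n) \<Rightarrow> (real ^ 'n \<Rightarrow> real) \<Rightarrow> real ^ 'n \<Rightarrow> real ^ 'n \<Rightarrow> real" where
  "g_est r \<theta>hat chat x = gauss_density (\<theta>hat x) (chat x * r)"

(* \<theta> is fixed before the infimum is taken, so the scale estimate may be chosen depending on it. *)
definition oracle_risk :: "real \<Rightarrow> real ^ 'n \<Rightarrow> (real ^ 'n \<Rightarrow> real ^ 'n) \<Rightarrow> ereal" where
  "oracle_risk r \<theta> \<theta>hat =
     (INF chat \<in> {chat. chat \<in> borel_measurable borel \<and> (\<forall>x. 0 < chat x)}.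
        pred_risk r \<theta> (g_est r \<theta>hat chat))"

definition quad_risk :: "real ^ 'n \<Rightarrow> (real ^ 'n \<Rightarrow> real ^ 'n) \<Rightarrow> real" where
  "quad_risk \<theta> \<theta>hat = (LINT x | gauss \<theta> 1. (norm (\<theta>hat x - \<theta>))\<^sup>2)"

definition ideal_flat :: "real \<Rightarrow> real ^ 'n \<Rightarrow> (real ^ 'n \<Rightarrow> real ^ 'n) \<Rightarrow> real" where
  "ideal_flat r \<theta> \<theta>hat = 1 + quad_risk \<theta> \<theta>hat / (real CARD('n) * r)"

(* At the null set x = 0 division by zero gives the estimate 0 and the value n for U_plus. *)
definition js_est :: "real ^ 'n \<Rightarrow> real ^ 'n" where
  "js_est x = (1 - (real CARD('n) - 2) / (norm x)\<^sup>2) *\<^sub>R x"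

definition U_plus :: "real ^ 'n \<Rightarrow> real" where
  "U_plus x = max (real CARD('n) - (real CARD('n) - 2)\<^sup>2 / (norm x)\<^sup>2) 0"

definition js_scale :: "real \<Rightarrow> real ^ 'n \<Rightarrow> real" where
  "js_scale r x = 1 + U_plus x / (real CARD('n) * r)"

definition g_js :: "real \<Rightarrow> real ^ 'n \<Rightarrow> real ^ 'n \<Rightarrow> real" where
  "g_js r = g_est r js_est (js_scale r)"

definition a_const :: "nat \<Rightarrow> real" where
  "a_const n = 3 * (1 - (real n - 2) powi (-1)) powi (-2)"

definition e_const :: "nat \<Rightarrow> real" where
  "e_const n = sqrt 3 * (\<Prod>i\<in>{1..4::nat}. 1 - (2 * real i + 1) / real n) powr (-1/2)"

definition f_const :: "nat \<Rightarrow> real" where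
  "f_const n = (1 - sqrt (ln (real n) / real n)) powi (-2)"

definition k2_const :: "nat \<Rightarrow> real" where
  "k2_const n = max (e_const n) (f_const n)"

definition b_const :: "nat \<Rightarrow> real" where
  "b_const n = 4 * (2 + a_const n + k2_const n)"

definition l_const :: "nat \<Rightarrow> real" where
  "l_const n = 3 * (1 - 2 / real n) powi (-2)"

end

theory Submission
  imports Defs
begin

text \<open>
  With \<open>A = 1 + \<parallel>js_est x - \<theta>\<parallel>\<^sup>2 / (n r)\<close> and a scale \<open>c \<ge> 1\<close>, the divergence is
  \<open>n / 2 (ln c - 1 + A / c)\<close>, which is minimal at \<open>c = A\<close>, and the ideal flattening coefficient
  \<open>f\<close> is the mean of \<open>A\<close>. Elementary inequalities for \<open>ln\<close> bound all errors
  by the mean squares of \<open>c - f\<close> and \<open>A - f\<close>, that is, by the variances of the unbiased risk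
  estimate \<open>U\<close> and of the loss. Stein's identity, obtained from the translation invariance of
  Lebesgue measure, expresses both variances through the moments \<open>E (1 / \<parallel>X\<parallel>\<^sup>2)\<^sup>k\<close>
  for \<open>k \<le> 3\<close>, and the recurrences between these moments show that the variances are at most
  \<open>18 n / 5\<close> and \<open>78 n / 5\<close> uniformly in \<open>\<theta>\<close>. The constants of the theorem leave room for this:
  the terms in \<open>r powi (-2)\<close> alone suffice.
\<close>

subsection \<open>Gaussian measures and Stein's identity\<close>

text \<open>The first obstacle is the pole of \<open>1 / (norm x)\<^sup>2\<close> at the origin:
  Stein's identity is wanted for functions differentiable only off 0, and it cannot be applied to
  inverse moments before these are known to be finite. The former is resolved by working along
  lines, almost all of which miss the origin, the latter by replacing
  \<open>(norm x)\<^sup>2\<close> with \<open>(norm x)\<^sup>2 + \<epsilon>\<close> and letting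
  \<epsilon> tend to 0. The second obstacle is uniformity in \<theta>. The variance of
  \<open>U\<close> is (n - 2)^4 times that of the inverse squared norm and has to be of order n, so
  bounding its two terms separately would lose the cancellation. Two exact identities, in which
  \<theta> enters only through \<open>\<theta> \<bullet> \<theta>\<close>, allow \<theta> to be
  eliminated first. Dimension 10 makes the fourth inverse moment finite, the highest one used for
  integrability. It also fixes the numbers: the variance bounds lead to the coefficients 66/5 and
  144/5 of \<open>r powi (-2)\<close>, whereas the constants satisfy a + b \<ge> 27 and a + b + l
  \<ge> 30.\<close>

lemma lborel_integral_translate:
  fixes F :: "'a::euclidean_space \<Rightarrow> real"
  assumes [measurable]: "F \<in> borel_measurable borel"
  shows "(\<integral>x. F (x + c) \<partial>lborel) = (\<integral>x. F x \<partial>lborel)"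
    and "integrable lborel (\<lambda>x. F (x + c)) \<longleftrightarrow> integrable lborel F"
proof -
  have "(\<integral>x. F x \<partial>lborel) = (\<integral>x. F x \<partial>distr lborel borel ((+) c))"
    by (simp add: lborel_distr_plus)
  also have "\<dots> = (\<integral>x. F (c + x) \<partial>lborel)"
    by (rule integral_distr) auto
  finally show "(\<integral>x. F (x + c) \<partial>lborel) = (\<integral>x. F x \<partial>lborel)"
    by (simp add: add.commute)
  have "integrable lborel F \<longleftrightarrow> integrable (distr lborel borel ((+) c)) F"
    by (simp add: lborel_distr_plus)
  also have "\<dots> \<longleftrightarrow> integrable lborel (\<lambda>x. F (c + x))"
    by (rule integrable_distr_eq) auto
  finally show "integrable lborel (\<lambda>x. F (x + c)) \<longleftrightarrow> integrable lborel F"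
    by (simp add: add.commute)
qed

lemma lborel_integral_reflect:
  fixes F :: "'a::euclidean_space \<Rightarrow> real"
  assumes [measurable]: "F \<in> borel_measurable borel"
  shows "(\<integral>x. F (- x) \<partial>lborel) = (\<integral>x. F x \<partial>lborel)"
    and "integrable lborel (\<lambda>x. F (- x)) \<longleftrightarrow> integrable lborel F"
proof -
  have eq: "distr lborel borel uminus = (lborel :: 'a measure)"
    using lborel_affine[of "-1" "0::'a"] by (simp add: density_1)
  have "(\<integral>x. F x \<partial>lborel) = (\<integral>x. F x \<partial>distr lborel borel uminus)"
    by (simp add: eq)
  also have "\<dots> = (\<integral>x. F (- x) \<partial>lborel)"
    by (rule integral_distr) auto
  finally show "(\<integral>x. F (- x) \<partial>lborel) = (\<integral>x. F x \<partial>lborel)" ..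
  have "integrable lborel F \<longleftrightarrow> integrable (distr lborel borel uminus) F"
    by (simp add: eq)
  also have "\<dots> \<longleftrightarrow> integrable lborel (\<lambda>x. F (- x))"
    by (rule integrable_distr_eq) auto
  finally show "integrable lborel (\<lambda>x. F (- x)) \<longleftrightarrow> integrable lborel F" ..
qed

text \<open>On the segment from x to x + u the fundamental theorem of calculus writes F (x + u) - F
  x as an integral of \<open>G\<close>. After integration over x, Fubini and translation invariance
  turn one side into the integral of \<open>G\<close> and the other into 0. Translation invariance
  thus takes the place of an estimate of boundary terms.\<close>

lemma integral_directional_derivative_eq_0:
  fixes F G :: "'a::euclidean_space \<Rightarrow> real"
  assumes F: "integrable lborel F" and G: "integrable lborel G"
    and deriv: "AE x in lborel. \<forall>t. ((\<lambda>s. F (x + s *\<^sub>R u)) has_real_derivative G (x + t *\<^sub>R u)) (at t)"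
  shows "(\<integral>x. G x \<partial>lborel) = 0"
proof -
  have [measurable]: "F \<in> borel_measurable borel" "G \<in> borel_measurable borel"
    using F G by auto
  \<comment> \<open>The indicator confines t to a set of length 1, so that \<open>H\<close> is
    integrable on the product with the same norm as \<open>G\<close>, and Fubini applies.\<close>
  define H where "H = (\<lambda>(t::real) x. indicator {0..1} t * G (x + t *\<^sub>R u))"
  have Hint: "integrable (lborel \<Otimes>\<^sub>M lborel) (case_prod H)"
  proof (rule lborel_pair.Fubini_integrable)
    show "case_prod H \<in> borel_measurable (lborel \<Otimes>\<^sub>M lborel)"
      unfolding H_def by measurable
    have "(\<integral>x. norm (case_prod H (t, x)) \<partial>lborel) = indicator {0..1} t * (\<integral>x. \<bar>G x\<bar> \<partial>lborel)" for t
      using lborel_integral_translate(1)[of "\<lambda>x. \<bar>G x\<bar>" "t *\<^sub>R u"]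
      by (simp add: H_def abs_mult)
    then show "integrable lborel (\<lambda>t. \<integral>x. norm (case_prod H (t, x)) \<partial>lborel)"
      by simp
    show "AE t in lborel. integrable lborel (\<lambda>x. case_prod H (t, x))"
      using G by (simp add: H_def lborel_integral_translate(2))
  qed
  have "AE x in lborel. F (x + u) - F x = (\<integral>t. H t x \<partial>lborel)"
    using deriv lborel_pair.AE_integrable_snd[OF Hint]
  proof eventually_elim
    case (elim x)
    have si: "set_integrable lborel {0..1::real} (\<lambda>t. G (x + t *\<^sub>R u))"
      using elim(2) by (simp add: set_integrable_def H_def)
    have "((\<lambda>t. G (x + t *\<^sub>R u)) has_integral (F (x + 1 *\<^sub>R u) - F (x + 0 *\<^sub>R u))) {0..1}"
      using elim(1)
      by (intro fundamental_theorem_of_calculus)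
         (auto simp: has_real_derivative_iff_has_vector_derivative
               intro: has_vector_derivative_at_within)
    then show ?case
      using set_borel_integral_eq_integral(2)[OF si]
      by (simp add: H_def integral_unique set_lebesgue_integral_def)
  qed
  then have "(\<integral>x. F (x + u) - F x \<partial>lborel) = (\<integral>x. (\<integral>t. H t x \<partial>lborel) \<partial>lborel)"
    using lborel_pair.integrable_snd[OF Hint] by (intro integral_cong_AE) auto
  also have "\<dots> = (\<integral>t. (\<integral>x. H t x \<partial>lborel) \<partial>lborel)"
    using Hint by (rule lborel_pair.Fubini_integral)
  also have "\<dots> = (\<integral>t. indicator {0..1::real} t * (\<integral>x. G x \<partial>lborel) \<partial>lborel)"
    by (simp add: H_def lborel_integral_translate(1))
  also have "\<dots> = (\<integral>x. G x \<partial>lborel)"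
    by simp
  finally show ?thesis
    using F by (simp add: lborel_integral_translate)
qed

text \<open>A line in direction u meets the origin only if its starting point lies in
  \<open>span {u}\<close>, a null set in dimension at least 2. Hence a function singular at 0 is
  still differentiable along almost every whole line.\<close>

lemma AE_line_avoids_0:
  fixes u :: "'a::euclidean_space"
  assumes "2 \<le> DIM('a)"
  shows "AE x in lborel. \<forall>t. x + t *\<^sub>R u \<noteq> 0"
proof -
  have "dim (span {u}) \<le> 1"
    using dim_le_card'[of "{u}"] by (simp add: dim_span)
  then have "negligible (span {u})"
    using assms by (intro negligible_lowdim) linarith
  then have "AE x in lebesgue. x \<notin> span {u}"
    by (intro AE_I') (auto simp: negligible_iff_null_sets)
  then have "AE x in lborel. x \<notin> span {u}"
    using AE_completion_iff  closed_span[of "{u}"] by (auto simp: AE_completion_iff)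
  then show ?thesis
  proof eventually_elim
    case (elim x)
    show ?case
    proof (intro allI notI)
      fix t assume "x + t *\<^sub>R u = 0"
      then have "x = (- t) *\<^sub>R u"
        by (simp add: eq_neg_iff_add_eq_0)
      with elim show False
        by (metis span_base span_scale singletonI)
    qed
  qed
qed

lemma gauss_density_eq:
  fixes m :: "real ^ 'n"
  assumes "0 < v"
  shows "gauss_density m v x = (1 / sqrt (2 * pi * v)) ^ CARD('n) * exp (- (norm (x - m))\<^sup>2 / (2 * v))"
proof -
  have "(norm (x - m))\<^sup>2 = (\<Sum>i\<in>UNIV. (x $ i - m $ i)\<^sup>2)"
    unfolding power2_norm_eq_inner by (simp add: inner_vec_def power2_eq_square)
  then have "exp (- (norm (x - m))\<^sup>2 / (2 * v)) = (\<Prod>i\<in>UNIV. exp (- (x $ i - m $ i)\<^sup>2 / (2 * v)))"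
    by (simp add: exp_sum sum_divide_distrib sum_negf flip: sum_negf)
  then show ?thesis
    using assms by (simp add: gauss_density_def normal_density_def prod_dividef power_one_over)
qed

lemma gauss_density_pos: "0 < v \<Longrightarrow> 0 < gauss_density m v x"
  by (simp add: gauss_density_eq)

lemma gauss_density_nonneg [simp]: "0 \<le> gauss_density m v x"
  by (simp add: gauss_density_def prod_nonneg)

lemma borel_measurable_gauss_density [measurable]: "gauss_density m v \<in> borel_measurable borel"
  unfolding gauss_density_def by measurable

lemma nn_integral_gauss_density:
  fixes m :: "real ^ 'n"
  assumes v: "0 < v"
  shows "(\<integral>\<^sup>+x. gauss_density m v x \<partial>lborel) = 1"
proof -
  define f where "f b y = normal_density (m \<bullet> b) (sqrt v) y" for b :: "real ^ 'n" and y
  have Basis_eq: "(Basis :: (real ^ 'n) set) = (\<lambda>i. axis i 1) ` UNIV"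
    by (auto simp: Basis_vec_def)
  have "gauss_density m v x = (\<Prod>b\<in>Basis. f b (x \<bullet> b))" for x :: "real ^ 'n"
    unfolding Basis_eq
    by (subst prod.reindex) (auto simp: inj_on_def axis_eq_axis f_def gauss_density_def cart_eq_inner_axis)
  then have "(\<integral>\<^sup>+x. gauss_density m v x \<partial>lborel) = (\<integral>\<^sup>+x. (\<Prod>b\<in>Basis. ennreal (f b (x \<bullet> b))) \<partial>lborel)"
    by (simp add: prod_ennreal f_def)
  also have "\<dots> = (\<Prod>b\<in>Basis. (\<integral>\<^sup>+y. f b y \<partial>lborel))"
    by (rule nn_integral_lborel_prod) (auto simp: f_def)
  also have "\<dots> = 1"
    using v by (intro prod.neutral) (simp add: f_def nn_integral_eq_integral)
  finally show ?thesis .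
qed

lemma sets_gauss [simp, measurable_cong]: "sets (gauss m v) = sets borel"
  by (simp add: gauss_def)

lemma space_gauss [simp]: "space (gauss m v) = UNIV"
  by (simp add: gauss_def)

lemma prob_space_gauss: "0 < v \<Longrightarrow> prob_space (gauss m v)"
  by (rule prob_spaceI) (simp add: gauss_def emeasure_density nn_integral_gauss_density)

lemma integrable_gauss_iff:
  fixes f :: "real ^ 'n \<Rightarrow> real"
  assumes "f \<in> borel_measurable borel"
  shows "integrable (gauss m v) f \<longleftrightarrow> integrable lborel (\<lambda>x. gauss_density m v x * f x)"
  using assms by (simp add: gauss_def integrable_density)

lemma integral_gauss:
  fixes f :: "real ^ 'n \<Rightarrow> real"
  assumes "f \<in> borel_measurable borel"
  shows "(\<integral>x. f x \<partial>gauss m v) = (\<integral>x. gauss_density m v x * f x \<partial>lborel)"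
  using assms by (simp add: gauss_def integral_density)

lemma AE_gauss:
  assumes "AE x in lborel. P x"
  shows "AE x in gauss m v. P x"
  unfolding gauss_def using assms by (subst AE_density) auto

lemma AE_gauss_nonzero: "AE x in gauss m v. x \<noteq> 0"
  by (intro AE_gauss AE_lborel_singleton)

lemma has_real_derivative_gauss_density_line:
  fixes m :: "real ^ 'n"
  assumes v: "0 < v"
  shows "((\<lambda>s. gauss_density m v (x + s *\<^sub>R u)) has_real_derivative
           - (((x + t *\<^sub>R u - m) \<bullet> u) / v * gauss_density m v (x + t *\<^sub>R u))) (at t)"
proof -
  have *: "((\<lambda>s. (norm (x + s *\<^sub>R u - m))\<^sup>2) has_real_derivative 2 * ((x + t *\<^sub>R u - m) \<bullet> u)) (at t)"
    unfolding power2_norm_eq_inner has_field_derivative_def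
    by (rule derivative_eq_intros refl | simp add: fun_eq_iff inner_commute algebra_simps)+
  show ?thesis
    unfolding gauss_density_eq[OF v]
    by (rule derivative_eq_intros * refl | use v in \<open>simp add: field_simps\<close>)+
qed

text \<open>This is \<open>integral_directional_derivative_eq_0\<close> for the density times
  \<open>h\<close>; differentiating the Gaussian factor produces the term with (x - m) \<bullet> u.
  Asking for differentiability off the origin admits negative powers of the norm.\<close>

lemma stein_directional:
  fixes m u :: "real ^ 'n"
  assumes v: "0 < v" and dim: "2 \<le> CARD('n)"
    and deriv: "\<And>x. x \<noteq> 0 \<Longrightarrow> (h has_derivative h' x) (at x)"
    and h: "integrable (gauss m v) h"
    and h'u: "integrable (gauss m v) (\<lambda>x. h' x u)"
    and hm: "integrable (gauss m v) (\<lambda>x. ((x - m) \<bullet> u) * h x)"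
  shows "(\<integral>x. ((x - m) \<bullet> u) * h x \<partial>gauss m v) = v * (\<integral>x. h' x u \<partial>gauss m v)"
proof -
  let ?\<phi> = "gauss_density m v"
  have [measurable]: "h \<in> borel_measurable borel" "(\<lambda>x. h' x u) \<in> borel_measurable borel"
    using h h'u by (auto dest!: borel_measurable_integrable)
  define G where "G x = ?\<phi> x * h' x u - (?\<phi> x * (((x - m) \<bullet> u) * h x)) / v" for x
  have ints: "integrable lborel (\<lambda>x. ?\<phi> x * h' x u)"
       "integrable lborel (\<lambda>x. ?\<phi> x * (((x - m) \<bullet> u) * h x))"
    using h'u hm by (simp_all add: integrable_gauss_iff)
  have "(\<integral>x. G x \<partial>lborel) = 0"
  proof (rule integral_directional_derivative_eq_0)
    show "integrable lborel (\<lambda>x. ?\<phi> x * h x)"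
      using h by (simp add: integrable_gauss_iff)
    show "integrable lborel G"
      unfolding G_def using ints by auto
    have "AE x in lborel. \<forall>t. x + t *\<^sub>R u \<noteq> 0"
      using dim by (intro AE_line_avoids_0) simp
    then show "AE x in lborel. \<forall>t. ((\<lambda>s. ?\<phi> (x + s *\<^sub>R u) * h (x + s *\<^sub>R u))
                 has_real_derivative G (x + t *\<^sub>R u)) (at t)"
    proof eventually_elim
      case (elim x)
      show ?case
      proof
        fix t
        have d: "(h has_derivative h' (x + t *\<^sub>R u)) (at (x + t *\<^sub>R u))"
          using elim deriv by blast
        have "((\<lambda>s. x + s *\<^sub>R u) has_derivative (\<lambda>s. s *\<^sub>R u)) (at t)"
          by (rule derivative_eq_intros refl | simp)+
        from diff_chain_at[OF this d]
        have "((\<lambda>s. h (x + s *\<^sub>R u)) has_derivative (\<lambda>s. h' (x + t *\<^sub>R u) (s *\<^sub>R u))) (at t)"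
          by (simp add: o_def)
        moreover have "h' (x + t *\<^sub>R u) (s *\<^sub>R u) = h' (x + t *\<^sub>R u) u * s" for s
          using linear_scale[OF has_derivative_linear[OF d], of s u] by simp
        ultimately have "((\<lambda>s. h (x + s *\<^sub>R u)) has_real_derivative h' (x + t *\<^sub>R u) u) (at t)"
          by (simp add: has_field_derivative_def)
        from DERIV_mult[OF has_real_derivative_gauss_density_line[OF v] this]
        show "((\<lambda>s. ?\<phi> (x + s *\<^sub>R u) * h (x + s *\<^sub>R u)) has_real_derivative G (x + t *\<^sub>R u)) (at t)"
          by (rule DERIV_cong) (simp add: G_def field_simps)
      qed
    qed
  qed
  then have "(\<integral>x. ?\<phi> x * h' x u \<partial>lborel) = (\<integral>x. ?\<phi> x * (((x - m) \<bullet> u) * h x) \<partial>lborel) / v"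
    unfolding G_def using ints by (subst (asm) Bochner_Integration.integral_diff) auto
  then show ?thesis
    using v by (simp add: integral_gauss)
qed

text \<open>The directional identity is used on each axis for \<open>h\<close> times a component of
  the field, and the results are summed; \<alpha> n is the divergence of the field. Affine fields
  suffice because only x, x - m and constant vectors occur later. The weight
  \<open>(1 + norm x)\<^sup>2\<close> pays for the two affine factors x - m and \<alpha> x +
  c.\<close>

lemma stein_field:
  fixes m c :: "real ^ 'n"
  assumes v: "0 < v" and dim: "2 \<le> CARD('n)"
    and deriv: "\<And>x. x \<noteq> 0 \<Longrightarrow> (h has_derivative (\<lambda>w. k x \<bullet> w)) (at x)"
    and meas [measurable]: "h \<in> borel_measurable borel" "k \<in> borel_measurable borel"
    and h: "integrable (gauss m v) (\<lambda>x. (1 + norm x)\<^sup>2 * \<bar>h x\<bar>)"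
    and k: "integrable (gauss m v) (\<lambda>x. (1 + norm x)\<^sup>2 * norm (k x))"
  shows "(\<integral>x. ((x - m) \<bullet> (\<alpha> *\<^sub>R x + c)) * h x \<partial>gauss m v)
       = v * (\<integral>x. \<alpha> * real CARD('n) * h x + k x \<bullet> (\<alpha> *\<^sub>R x + c) \<partial>gauss m v)"
proof -
  let ?V = "\<lambda>x. \<alpha> *\<^sub>R x + c"
  define hi where "hi i x = h x * ?V x $ i" for i x
  define D where "D i x w = (k x \<bullet> w) * ?V x $ i + h x * (\<alpha> * w $ i)" for i x w
  \<comment> \<open>The product of the linear growth constants of x - m and of the field, so that
    \<open>B * (1 + norm x)\<^sup>2\<close> dominates the product of their components.\<close>
  define B where "B = (1 + norm m) * (\<bar>\<alpha>\<bar> + norm c)"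
  have Vi: "\<bar>?V x $ i\<bar> \<le> (\<bar>\<alpha>\<bar> + norm c) * (1 + norm x)" for x i
  proof -
    have "\<bar>?V x $ i\<bar> \<le> norm (?V x)" by (rule component_le_norm_cart)
    also have "\<dots> \<le> \<bar>\<alpha>\<bar> * norm x + norm c"
      by (metis norm_triangle_ineq norm_scaleR)
    also have "\<dots> \<le> (\<bar>\<alpha>\<bar> + norm c) * (1 + norm x)"
      by (simp add: algebra_simps)
    finally show ?thesis .
  qed
  have mono: "1 + norm x \<le> (1 + norm x)\<^sup>2" for x :: "real ^ 'n"
    using power_increasing[of 1 2 "1 + norm x"] by simp
  have B1: "(\<bar>\<alpha>\<bar> + norm c) \<le> B"
    unfolding B_def using mult_right_mono[of 1 "1 + norm m" "\<bar>\<alpha>\<bar> + norm c"] by simp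
  have B0: "0 \<le> B" unfolding B_def by simp
  have Vi2: "\<bar>?V x $ i\<bar> \<le> B * (1 + norm x)\<^sup>2" for x i
    using Vi[of x i] mult_mono[OF B1 mono[of x] B0] by simp
  have V_meas [measurable]: "(\<lambda>x. ?V x $ i) \<in> borel_measurable borel" "(\<lambda>x. k x $ i) \<in> borel_measurable borel" for i
    unfolding cart_eq_inner_axis by measurable
  have int_hi: "integrable (gauss m v) (hi i)" for i
  proof (rule Bochner_Integration.integrable_bound)
    show "integrable (gauss m v) (\<lambda>x. B * ((1 + norm x)\<^sup>2 * \<bar>h x\<bar>))"
      using h by simp
    show "hi i \<in> borel_measurable (gauss m v)"
      unfolding hi_def by measurable
    show "AE x in gauss m v. norm (hi i x) \<le> norm (B * ((1 + norm x)\<^sup>2 * \<bar>h x\<bar>))"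
    proof (rule AE_I2)
      fix x
      show "norm (hi i x) \<le> norm (B * ((1 + norm x)\<^sup>2 * \<bar>h x\<bar>))"
        using mult_right_mono[OF Vi2[of x i], of "\<bar>h x\<bar>"] B0
        by (simp add: hi_def abs_mult mult_ac)
    qed
  qed
  have int_h: "integrable (gauss m v) h"
  proof (rule Bochner_Integration.integrable_bound[OF h])
    show "AE x in gauss m v. norm (h x) \<le> norm ((1 + norm x)\<^sup>2 * \<bar>h x\<bar>)"
      by (rule AE_I2) (simp add: mult_left_le_one_le mult_ge1_I abs_mult one_le_power mult_le_cancel_right1)
  qed simp
  have int_kV: "integrable (gauss m v) (\<lambda>x. k x $ i * ?V x $ i)" for i
  proof (rule Bochner_Integration.integrable_bound)
    show "integrable (gauss m v) (\<lambda>x. B * ((1 + norm x)\<^sup>2 * norm (k x)))"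
      using k by simp
    show "AE x in gauss m v. norm (k x $ i * ?V x $ i) \<le> norm (B * ((1 + norm x)\<^sup>2 * norm (k x)))"
    proof (rule AE_I2)
      fix x
      have "\<bar>k x $ i\<bar> * \<bar>?V x $ i\<bar> \<le> norm (k x) * (B * (1 + norm x)\<^sup>2)"
        using Vi2[of x i] component_le_norm_cart[of "k x" i] by (intro mult_mono) auto
      then show "norm (k x $ i * ?V x $ i) \<le> norm (B * ((1 + norm x)\<^sup>2 * norm (k x)))"
        using B0 by (simp add: abs_mult mult_ac)
    qed
  qed measurable
  have D_axis: "D i x (axis i 1) = k x $ i * ?V x $ i + \<alpha> * h x" for i x
    by (simp add: D_def cart_eq_inner_axis[symmetric])
  have int_D: "integrable (gauss m v) (\<lambda>x. D i x (axis i 1))" for i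
    unfolding D_axis using int_kV int_h by simp
  have int_mh: "integrable (gauss m v) (\<lambda>x. ((x - m) \<bullet> axis i 1) * hi i x)" for i
  proof (rule Bochner_Integration.integrable_bound)
    show "integrable (gauss m v) (\<lambda>x. B * ((1 + norm x)\<^sup>2 * \<bar>h x\<bar>))"
      using h by simp
    show "(\<lambda>x. ((x - m) \<bullet> axis i 1) * hi i x) \<in> borel_measurable (gauss m v)"
      unfolding hi_def by measurable
    show "AE x in gauss m v. norm (((x - m) \<bullet> axis i 1) * hi i x) \<le> norm (B * ((1 + norm x)\<^sup>2 * \<bar>h x\<bar>))"
    proof (rule AE_I2)
      fix x
      have "\<bar>(x - m) $ i\<bar> \<le> norm (x - m)" by (rule component_le_norm_cart)
      also have "\<dots> \<le> norm x + norm m" by (rule norm_triangle_ineq4)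
      also have "\<dots> \<le> (1 + norm m) * (1 + norm x)" by (simp add: algebra_simps)
      finally have "\<bar>(x - m) $ i\<bar> * \<bar>?V x $ i\<bar> \<le> ((1 + norm m) * (1 + norm x)) * ((\<bar>\<alpha>\<bar> + norm c) * (1 + norm x))"
        using Vi[of x i] by (intro mult_mono) auto
      also have "\<dots> = B * (1 + norm x)\<^sup>2"
        by (simp add: B_def power2_eq_square)
      finally have "\<bar>(x - m) $ i\<bar> * \<bar>?V x $ i\<bar> * \<bar>h x\<bar> \<le> B * (1 + norm x)\<^sup>2 * \<bar>h x\<bar>"
        by (rule mult_right_mono) simp
      then show "norm (((x - m) \<bullet> axis i 1) * hi i x) \<le> norm (B * ((1 + norm x)\<^sup>2 * \<bar>h x\<bar>))"
        using B0 unfolding hi_def cart_eq_inner_axis[symmetric] by (simp add: abs_mult mult_ac)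
    qed
  qed
  have stein_i: "(\<integral>x. ((x - m) \<bullet> axis i 1) * hi i x \<partial>gauss m v) = v * (\<integral>x. D i x (axis i 1) \<partial>gauss m v)" for i
  proof (rule stein_directional[where h = "hi i" and h' = "D i" and u = "axis i 1", OF v dim _ int_hi int_D int_mh])
    fix x :: "real ^ 'n" assume "x \<noteq> 0"
    then show "(hi i has_derivative D i x) (at x)"
      unfolding hi_def D_def
      by (auto intro!: derivative_eq_intros deriv bounded_linear_imp_has_derivative
          bounded_linear_vec_nth simp: fun_eq_iff algebra_simps)
  qed
  have "(\<integral>x. ((x - m) \<bullet> ?V x) * h x \<partial>gauss m v) = (\<integral>x. (\<Sum>i\<in>UNIV. ((x - m) \<bullet> axis i 1) * hi i x) \<partial>gauss m v)"
    by (simp only: inner_vec_def[of _ "?V _"] hi_def sum_distrib_left sum_distrib_right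
        cart_eq_inner_axis[symmetric] inner_real_def mult_ac)
  also have "\<dots> = (\<Sum>i\<in>UNIV. v * (\<integral>x. D i x (axis i 1) \<partial>gauss m v))"
    using int_mh by (simp add: stein_i)
  also have "\<dots> = v * (\<integral>x. (\<Sum>i\<in>UNIV. D i x (axis i 1)) \<partial>gauss m v)"
    using int_D by (simp add: sum_distrib_left)
  also have "(\<lambda>x. \<Sum>i\<in>UNIV. D i x (axis i 1)) = (\<lambda>x. \<alpha> * real CARD('n) * h x + k x \<bullet> ?V x)"
    unfolding D_axis sum.distrib by (simp add: inner_vec_def fun_eq_iff)
  finally show ?thesis .
qed

section \<open>Polynomial growth at infinity and poles at the origin\<close>

lemma power_le_exp:
  fixes y :: real
  assumes "0 \<le> y"
  shows "y ^ k \<le> real k ^ k * exp y"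
proof (cases "k = 0")
  case False
  then have "y ^ k = real k ^ k * (y / real k) ^ k"
    by (simp add: power_divide)
  also have "\<dots> \<le> real k ^ k * (1 + y / real k) ^ k"
    using assms by (intro mult_left_mono power_mono) auto
  also have "\<dots> \<le> real k ^ k * exp y"
    using assms False exp_ge_one_plus_x_over_n_power_n[of k y] by (intro mult_left_mono) auto
  finally show ?thesis .
qed (use assms in simp)

text \<open>A polynomial costs at most an exponential of the norm, and completing the square bounds
  that by a multiple of exp (t^2 / (4 v)). This uses up half of the Gaussian exponent; what remains
  is a Gaussian of variance 2 v.\<close>

lemma integrable_gauss_norm_power:
  fixes m :: "real ^ 'n"
  assumes v: "0 < v"
  shows "integrable (gauss m v) (\<lambda>x. (1 + norm x) ^ k)"
proof -
  \<comment> \<open>The power of \<open>sqrt 2\<close> is the ratio of the normalizing factors for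
    the variances v and 2 v.\<close>
  define C where "C = sqrt 2 ^ CARD('n) * (real k ^ k * exp (1 + norm m + v))"
  have C0: "0 \<le> C"
    by (simp add: C_def)
  have bound: "gauss_density m v x * (1 + norm x) ^ k \<le> C * gauss_density m (2 * v) x" for x
  proof -
    define t where "t = norm (x - m)"
    have "norm x \<le> norm m + t"
      unfolding t_def using norm_triangle_ineq[of m "x - m"] by simp
    moreover have "t \<le> v + t\<^sup>2 / (4 * v)"
    proof -
      have "0 \<le> (t - 2 * v)\<^sup>2 / (4 * v)" using v by simp
      also have "\<dots> = v + t\<^sup>2 / (4 * v) - t"
        using v by (simp add: field_simps power2_eq_square)
      finally show ?thesis by simp
    qed
    ultimately have "exp (1 + norm x) \<le> exp (1 + norm m + v) * exp (t\<^sup>2 / (4 * v))"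
      by (simp flip: exp_add)
    then have "(1 + norm x) ^ k \<le> real k ^ k * (exp (1 + norm m + v) * exp (t\<^sup>2 / (4 * v)))"
      by (meson power_le_exp order_trans mult_left_mono norm_ge_zero of_nat_0_le_iff
          zero_le_power add_nonneg_nonneg zero_le_one)
    then have "exp (- t\<^sup>2 / (2 * v)) * (1 + norm x) ^ k
        \<le> exp (- t\<^sup>2 / (2 * v)) * (real k ^ k * (exp (1 + norm m + v) * exp (t\<^sup>2 / (4 * v))))"
      by (rule mult_left_mono) simp
    also have "\<dots> = real k ^ k * exp (1 + norm m + v) * exp (- t\<^sup>2 / (2 * (2 * v)))"
    proof -
      have "exp (- t\<^sup>2 / (2 * v)) * exp (t\<^sup>2 / (4 * v)) = exp (- t\<^sup>2 / (2 * (2 * v)))"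
        unfolding exp_add[symmetric] using v by (simp add: field_simps)
      then show ?thesis by (simp add: mult_ac)
    qed
    finally have le: "exp (- t\<^sup>2 / (2 * v)) * (1 + norm x) ^ k
        \<le> real k ^ k * exp (1 + norm m + v) * exp (- t\<^sup>2 / (2 * (2 * v)))" .
    have "1 / sqrt (2 * pi * v) = sqrt 2 * (1 / sqrt (2 * pi * (2 * v)))"
      using v by (simp add: real_sqrt_mult field_simps)
    then have "(1 / sqrt (2 * pi * v)) ^ CARD('n) = sqrt 2 ^ CARD('n) * (1 / sqrt (2 * pi * (2 * v))) ^ CARD('n)"
      by (simp only: power_mult_distrib)
    then show ?thesis
      using mult_left_mono[OF le, of "(1 / sqrt (2 * pi * v)) ^ CARD('n)"] v
      by (simp add: gauss_density_eq C_def t_def mult_ac)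
  qed
  have "integrable lborel (\<lambda>x. gauss_density m (2 * v) x)"
    using nn_integral_gauss_density[of "2 * v" m] v by (intro integrableI_nonneg) auto
  then have "integrable lborel (\<lambda>x. C * gauss_density m (2 * v) x)"
    by simp
  then have "integrable lborel (\<lambda>x. gauss_density m v x * (1 + norm x) ^ k)"
    by (rule Bochner_Integration.integrable_bound)
       (use C0 in \<open>auto intro!: AE_I2 order_trans[OF bound] simp: abs_mult\<close>)
  then show ?thesis
    by (subst integrable_gauss_iff) auto
qed

text \<open>Only the order j of the pole is recorded, since every polynomial moment of a Gaussian is
  finite and the degree k at infinity can stay hidden. Measurability is included so that one
  structural derivation yields everything needed for integrability. The value at 0 is left
  free.\<close>

definition pole_growth :: "nat \<Rightarrow> (real ^ 'n \<Rightarrow> 'b::{real_normed_vector, second_countable_topology}) \<Rightarrow> bool" where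
  "pole_growth j f \<longleftrightarrow> f \<in> borel_measurable borel \<and>
     (\<exists>C k. 0 \<le> C \<and> (\<forall>x. x \<noteq> 0 \<longrightarrow> norm (f x) \<le> C * (1 + norm x) ^ k / norm x ^ j))"

lemma pole_growth_measurable: "pole_growth j f \<Longrightarrow> f \<in> borel_measurable borel"
  by (simp add: pole_growth_def)

lemma pole_growthI:
  assumes "f \<in> borel_measurable borel" "0 \<le> C"
    "\<And>x. x \<noteq> 0 \<Longrightarrow> norm (f x) \<le> C * (1 + norm x) ^ k / norm x ^ j"
  shows "pole_growth j f"
  using assms unfolding pole_growth_def by blast

lemma pole_growth_mono:
  assumes f: "pole_growth i f" and "i \<le> j"
  shows "pole_growth j f"
proof -
  obtain C k where C: "0 \<le> C" "\<And>x. x \<noteq> 0 \<Longrightarrow> norm (f x) \<le> C * (1 + norm x) ^ k / norm x ^ i"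
    using f unfolding pole_growth_def by blast
  show ?thesis
  proof (rule pole_growthI[OF pole_growth_measurable[OF f] C(1), of "k + (j - i)"])
    fix x :: "real ^ 'a" assume x: "x \<noteq> 0"
    have "norm (f x) \<le> C * (1 + norm x) ^ k / norm x ^ i" by (rule C(2)[OF x])
    also have "\<dots> = C * (1 + norm x) ^ k * norm x ^ (j - i) / norm x ^ j"
      using x \<open>i \<le> j\<close> by (simp add: field_simps flip: power_add)
    also have "\<dots> \<le> C * (1 + norm x) ^ k * (1 + norm x) ^ (j - i) / norm x ^ j"
      using C(1) by (intro divide_right_mono mult_left_mono power_mono) auto
    finally show "norm (f x) \<le> C * (1 + norm x) ^ (k + (j - i)) / norm x ^ j"
      by (simp add: power_add mult_ac)
  qed
qed

lemma pole_growth_const: "pole_growth 0 (\<lambda>x. c)"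
  by (rule pole_growthI[of _ "norm c" 0]) auto

lemma pole_growth_ident: "pole_growth 0 (\<lambda>x. x)"
  by (rule pole_growthI[of _ 1 1]) auto

lemma pole_growth_norm:
  assumes "pole_growth j f"
  shows "pole_growth j (\<lambda>x. norm (f x))"
  using assms by (auto simp: pole_growth_def)

lemma pole_growth_add:
  assumes f: "pole_growth i f" and g: "pole_growth j g"
  shows "pole_growth (max i j) (\<lambda>x. f x + g x)"
proof -
  have f': "pole_growth (max i j) f" and g': "pole_growth (max i j) g"
    using f g by (auto intro: pole_growth_mono)
  obtain C k where C: "0 \<le> C" "\<And>x. x \<noteq> 0 \<Longrightarrow> norm (f x) \<le> C * (1 + norm x) ^ k / norm x ^ max i j"
    using f' unfolding pole_growth_def by blast
  obtain D l where D: "0 \<le> D" "\<And>x. x \<noteq> 0 \<Longrightarrow> norm (g x) \<le> D * (1 + norm x) ^ l / norm x ^ max i j"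
    using g' unfolding pole_growth_def by blast
  show ?thesis
  proof (rule pole_growthI)
    show "(\<lambda>x. f x + g x) \<in> borel_measurable borel"
      using f g by (auto dest!: pole_growth_measurable)
    show "0 \<le> C + D" using C D by simp
    fix x :: "real ^ 'a" assume x: "x \<noteq> 0"
    have "norm (f x + g x) \<le> C * (1 + norm x) ^ k / norm x ^ max i j + D * (1 + norm x) ^ l / norm x ^ max i j"
      using C(2)[OF x] D(2)[OF x] norm_triangle_ineq[of "f x" "g x"] by linarith
    also have "\<dots> \<le> C * (1 + norm x) ^ max k l / norm x ^ max i j + D * (1 + norm x) ^ max k l / norm x ^ max i j"
      using C D by (intro add_mono divide_right_mono mult_left_mono power_increasing) auto
    also have "\<dots> = (C + D) * (1 + norm x) ^ max k l / norm x ^ max i j"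
      by (simp add: distrib_right add_divide_distrib)
    finally show "norm (f x + g x) \<le> (C + D) * (1 + norm x) ^ max k l / norm x ^ max i j" .
  qed
qed

text \<open>Common core of the rules for scalar multiples, products and inner products, which differ
  only in the norm inequality they supply.\<close>

lemma pole_growth_product:
  assumes f: "pole_growth i f" and g: "pole_growth j g"
    and meas: "h \<in> borel_measurable borel" and le: "\<And>x. norm (h x) \<le> norm (f x) * norm (g x)"
  shows "pole_growth (i + j) h"
proof -
  obtain C k where C: "0 \<le> C" "\<And>x. x \<noteq> 0 \<Longrightarrow> norm (f x) \<le> C * (1 + norm x) ^ k / norm x ^ i"
    using f unfolding pole_growth_def by blast
  obtain D l where D: "0 \<le> D" "\<And>x. x \<noteq> 0 \<Longrightarrow> norm (g x) \<le> D * (1 + norm x) ^ l / norm x ^ j"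
    using g unfolding pole_growth_def by blast
  show ?thesis
  proof (rule pole_growthI[OF meas])
    show "0 \<le> C * D" using C D by simp
    fix x :: "real ^ 'a" assume x: "x \<noteq> 0"
    have "norm (f x) * norm (g x) \<le> (C * (1 + norm x) ^ k / norm x ^ i) * (D * (1 + norm x) ^ l / norm x ^ j)"
      using C(2)[OF x] D(2)[OF x] C(1) by (intro mult_mono) auto
    then show "norm (h x) \<le> (C * D) * (1 + norm x) ^ (k + l) / norm x ^ (i + j)"
      using le[of x] by (simp add: power_add mult_ac)
  qed
qed

lemma pole_growth_scaleR:
  assumes "pole_growth i f" "pole_growth j g"
  shows "pole_growth (i + j) (\<lambda>x. f x *\<^sub>R g x)"
  using assms by (rule pole_growth_product)
    (use assms in \<open>auto dest!: pole_growth_measurable intro: borel_measurable_scaleR\<close>)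

lemma pole_growth_mult:
  fixes f g :: "real ^ 'n \<Rightarrow> real"
  assumes "pole_growth i f" "pole_growth j g"
  shows "pole_growth (i + j) (\<lambda>x. f x * g x)"
  using pole_growth_scaleR[OF assms] by simp

lemma pole_growth_inner:
  fixes f g :: "real ^ 'n \<Rightarrow> real ^ 'n"
  assumes "pole_growth i f" "pole_growth j g"
  shows "pole_growth (i + j) (\<lambda>x. f x \<bullet> g x)"
  using assms by (rule pole_growth_product)
    (use assms in \<open>auto dest!: pole_growth_measurable intro: Cauchy_Schwarz_ineq2\<close>)

lemma pole_growth_diff:
  assumes "pole_growth i f" "pole_growth j g"
  shows "pole_growth (max i j) (\<lambda>x. f x - g x)"
  using pole_growth_add[OF assms(1) pole_growth_scaleR[OF pole_growth_const assms(2)], of "-1"]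
  by simp

lemma pole_growth_minus:
  assumes "pole_growth j g"
  shows "pole_growth j (\<lambda>x. - g x)"
  using pole_growth_scaleR[OF pole_growth_const assms, of "-1"] by simp

lemma pole_growth_power:
  fixes f :: "real ^ 'n \<Rightarrow> real"
  assumes "pole_growth j f"
  shows "pole_growth (k * j) (\<lambda>x. f x ^ k)"
  by (induction k) (simp_all add: pole_growth_const pole_growth_mult[OF assms])

text \<open>As introduction rules these compute the pole order along the syntax of the term. For
  this reason later goals carry unevaluated orders such as \<open>max 0 0 + 0\<close>, which mirror
  the shape of the function.\<close>

lemmas pole_growth_intros = pole_growth_const pole_growth_ident pole_growth_norm pole_growth_inner
  pole_growth_scaleR pole_growth_mult pole_growth_power pole_growth_diff pole_growth_minus pole_growth_add

subsection \<open>Negative moments of the norm\<close>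

lemma integrable_gauss_pole_growth_0:
  fixes f :: "real ^ 'n \<Rightarrow> real"
  assumes v: "0 < v" and f: "pole_growth 0 f"
  shows "integrable (gauss m v) f"
proof -
  obtain C k where C: "0 \<le> C" "\<And>x. x \<noteq> 0 \<Longrightarrow> norm (f x) \<le> C * (1 + norm x) ^ k"
    using f by (auto simp: pole_growth_def)
  show ?thesis
  proof (rule Bochner_Integration.integrable_bound)
    show "integrable (gauss m v) (\<lambda>x. C * (1 + norm x) ^ k)"
      using integrable_gauss_norm_power[OF v, of m k] by simp
    show "f \<in> borel_measurable (gauss m v)"
      using pole_growth_measurable[OF f] by simp
    show "AE x in gauss m v. norm (f x) \<le> norm (C * (1 + norm x) ^ k)"
      using AE_gauss_nonzero
    proof eventually_elim
      case (elim x)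
      then show ?case using C(1) C(2)[of x] by simp
    qed
  qed
qed

text \<open>Points \<open>x\<close> and \<open>- x\<close> are paired: the density is larger at the one
  where \<open>m \<bullet> x\<close> is positive.\<close>

lemma gauss_integral_inner_even_nonneg:
  fixes m :: "real ^ 'n"
  assumes v: "0 < v" and int: "integrable (gauss m v) (\<lambda>x. (m \<bullet> x) * f x)"
    and meas [measurable]: "f \<in> borel_measurable borel"
    and even: "\<And>x. f (- x) = f x" and nn: "\<And>x. 0 \<le> f x"
  shows "0 \<le> (\<integral>x. (m \<bullet> x) * f x \<partial>gauss m v)"
proof -
  let ?\<phi> = "gauss_density m v"
  have i1: "integrable lborel (\<lambda>x. ?\<phi> x * ((m \<bullet> x) * f x))"
    using int by (subst (asm) integrable_gauss_iff) auto
  have i2: "integrable lborel (\<lambda>x. - (?\<phi> (- x) * ((m \<bullet> x) * f x)))"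
    using i1 lborel_integral_reflect(2)[of "\<lambda>x. ?\<phi> x * ((m \<bullet> x) * f x)"] by (simp add: even)
  have e2: "(\<integral>x. - (?\<phi> (- x) * ((m \<bullet> x) * f x)) \<partial>lborel) = (\<integral>x. ?\<phi> x * ((m \<bullet> x) * f x) \<partial>lborel)"
    using lborel_integral_reflect(1)[of "\<lambda>x. ?\<phi> x * ((m \<bullet> x) * f x)"] by (simp add: even)
  \<comment> \<open>By reflection both summands have the same integral, so this is twice the
    integral in question, while the integrand is the difference of the densities at x and - x times
    \<open>(m \<bullet> x) * f x\<close>.\<close>
  have "0 \<le> (\<integral>x. ?\<phi> x * ((m \<bullet> x) * f x) + - (?\<phi> (- x) * ((m \<bullet> x) * f x)) \<partial>lborel)"
  proof (rule integral_nonneg_AE, rule AE_I2)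
    fix x
    have "(norm (- x - m))\<^sup>2 - (norm (x - m))\<^sup>2 = 4 * (m \<bullet> x)"
      unfolding power2_norm_eq_inner by (simp add: algebra_simps inner_commute)
    moreover have mono: "C * exp (- a / (2 * v)) \<le> C * exp (- b / (2 * v)) \<longleftrightarrow> b \<le> a" if "0 < C" for a b C :: real
      using that v by (simp add: divide_simps)
    have "?\<phi> (- x) \<le> ?\<phi> x \<longleftrightarrow> (norm (x - m))\<^sup>2 \<le> (norm (- x - m))\<^sup>2"
      "?\<phi> x \<le> ?\<phi> (- x) \<longleftrightarrow> (norm (- x - m))\<^sup>2 \<le> (norm (x - m))\<^sup>2"
      unfolding gauss_density_eq[OF v] by (rule mono, use v in simp)+
    ultimately have iff: "?\<phi> (- x) \<le> ?\<phi> x \<longleftrightarrow> 0 \<le> m \<bullet> x" "?\<phi> x \<le> ?\<phi> (- x) \<longleftrightarrow> m \<bullet> x \<le> 0"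
      by linarith+
    have "0 \<le> (?\<phi> x - ?\<phi> (- x)) * (m \<bullet> x)"
      using iff by (cases "0 \<le> m \<bullet> x") (auto intro: mult_nonneg_nonneg mult_nonpos_nonpos)
    then have "0 \<le> (?\<phi> x - ?\<phi> (- x)) * (m \<bullet> x) * f x"
      using nn by simp
    then show "0 \<le> ?\<phi> x * ((m \<bullet> x) * f x) + - (?\<phi> (- x) * ((m \<bullet> x) * f x))"
      by (simp add: algebra_simps)
  qed
  also have "\<dots> = (\<integral>x. ?\<phi> x * ((m \<bullet> x) * f x) \<partial>lborel) + (\<integral>x. - (?\<phi> (- x) * ((m \<bullet> x) * f x)) \<partial>lborel)"
    using i1 i2 by (rule Bochner_Integration.integral_add)
  also have "\<dots> = 2 * (\<integral>x. (m \<bullet> x) * f x \<partial>gauss m v)"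
    unfolding e2 by (subst integral_gauss) auto
  finally show ?thesis by simp
qed

text \<open>With \<epsilon> > 0 all powers of \<open>g\<close> are bounded, so Stein's identity for
  the field x is available. Since g (x \<bullet> x) \<le> 1, the divergence of g^k x is at least (n
  - 2 k) g^k, and (x - m) \<bullet> x times g^k has mean at most that of g^(k - 1) because the term
  with m \<bullet> x has nonnegative mean by symmetry.\<close>

lemma inverse_norm_regularized_moment_step:
  fixes m :: "real ^ 'n" and \<epsilon> :: real
  defines "g \<equiv> \<lambda>x. 1 / ((norm x)\<^sup>2 + \<epsilon>)"
  assumes \<epsilon>: "0 < \<epsilon>" and dim: "2 \<le> CARD('n)" and k: "0 < k"
  shows "(real CARD('n) - 2 * real k) * (\<integral>x. g x ^ k \<partial>gauss m 1) \<le> (\<integral>x. g x ^ (k - 1) \<partial>gauss m 1)"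
proof -
  interpret prob_space "gauss m 1" by (rule prob_space_gauss) simp
  have [measurable]: "g \<in> borel_measurable borel"
    unfolding g_def by measurable
  have pos: "0 < (norm x)\<^sup>2 + \<epsilon>" for x :: "real ^ 'n"
    using \<epsilon> by (simp add: add_nonneg_pos)
  have g_pos: "0 < g x" for x
    unfolding g_def using pos by simp
  have g_le: "g x \<le> 1 / \<epsilon>" for x
    unfolding g_def using \<epsilon> by (intro divide_left_mono) (auto intro: mult_pos_pos pos)
  have g_tame: "pole_growth 0 g"
    by (rule pole_growthI[of _ "1 / \<epsilon>" 0]) (use \<epsilon> g_le g_pos in \<open>auto simp: less_imp_le\<close>)
  have gk_tame: "pole_growth 0 (\<lambda>x. g x ^ l)" for l
    using pole_growth_power[OF g_tame, of l] by simp
  have norm2: "(norm x)\<^sup>2 = x \<bullet> x" for x :: "real ^ 'n"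
    by (rule power2_norm_eq_inner)
  have deriv: "((\<lambda>x. g x ^ k) has_derivative (\<lambda>w. (- 2 * real k * g x ^ (k + 1)) *\<^sub>R x \<bullet> w)) (at x)" for x
  proof -
    have "((\<lambda>x. x \<bullet> x + \<epsilon>) has_derivative (\<lambda>w. 2 * (x \<bullet> w))) (at x)"
      by (auto intro!: derivative_eq_intros simp: inner_commute)
    from Deriv.has_derivative_inverse[OF _ this]
    have "(g has_derivative (\<lambda>w. - 2 * (g x)\<^sup>2 * (x \<bullet> w))) (at x)"
      using pos[of x] unfolding g_def norm2 by (simp add: inverse_eq_divide power2_eq_square)
    then show ?thesis
      by (rule has_derivative_eq_rhs[OF has_derivative_power])
         (use k in \<open>auto simp: fun_eq_iff power2_eq_square power_eq_if mult_ac\<close>)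
  qed
  have k_tame: "pole_growth 0 (\<lambda>x. (- 2 * real k * g x ^ (k + 1)) *\<^sub>R x)"
    using pole_growth_scaleR[OF pole_growth_mult[OF pole_growth_const[of "- 2 * real k"] gk_tame[of "k + 1"]] pole_growth_ident]
    by simp
  have sq_tame: "pole_growth 0 (\<lambda>x::real^'n. (1 + norm x)\<^sup>2)"
    using pole_growth_power[OF pole_growth_add[OF pole_growth_const[of 1] pole_growth_norm[OF pole_growth_ident]], of 2] by simp
  have "(\<integral>x. ((x - m) \<bullet> (1 *\<^sub>R x + 0)) * g x ^ k \<partial>gauss m 1)
      = 1 * (\<integral>x. 1 * real CARD('n) * g x ^ k + ((- 2 * real k * g x ^ (k + 1)) *\<^sub>R x) \<bullet> (1 *\<^sub>R x + 0) \<partial>gauss m 1)"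
    using pole_growth_mult[OF sq_tame pole_growth_norm[OF gk_tame[of k]]]
      pole_growth_mult[OF sq_tame pole_growth_norm[OF k_tame]]
    by (intro stein_field deriv dim)
       (auto intro!: integrable_gauss_pole_growth_0 pole_growth_measurable[OF k_tame])
  then have stein: "(\<integral>x. ((x - m) \<bullet> x) * g x ^ k \<partial>gauss m 1)
      = (\<integral>x. real CARD('n) * g x ^ k - 2 * real k * (g x ^ (k + 1) * (x \<bullet> x)) \<partial>gauss m 1)"
    by (simp add: mult_ac)
  have int_g: "integrable (gauss m 1) (\<lambda>x. g x ^ l)" for l
    by (rule integrable_gauss_pole_growth_0[OF _ gk_tame]) simp
  have int_gS: "integrable (gauss m 1) (\<lambda>x. g x ^ l * (c \<bullet> x))" for l c
    using pole_growth_mult[OF gk_tame[of l] pole_growth_inner[OF pole_growth_const[of c] pole_growth_ident]]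
    by (intro integrable_gauss_pole_growth_0) simp_all
  have int_gSS: "integrable (gauss m 1) (\<lambda>x. g x ^ l * (x \<bullet> x))" for l
    using pole_growth_mult[OF gk_tame[of l] pole_growth_inner[OF pole_growth_ident pole_growth_ident]]
    by (intro integrable_gauss_pole_growth_0) simp_all
  have gS: "g x ^ (l + 1) * (x \<bullet> x) \<le> g x ^ l" for l x
  proof -
    have "g x * (x \<bullet> x) \<le> 1"
      unfolding g_def using pos[of x] \<epsilon> by (simp add: norm2 divide_simps)
    then show ?thesis
      using mult_left_mono[of "g x * (x \<bullet> x)" 1 "g x ^ l"] g_pos[of x] by (simp add: mult_ac)
  qed
  have "real CARD('n) * (\<integral>x. g x ^ k \<partial>gauss m 1) - 2 * real k * (\<integral>x. g x ^ (k + 1) * (x \<bullet> x) \<partial>gauss m 1)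
      = (\<integral>x. ((x - m) \<bullet> x) * g x ^ k \<partial>gauss m 1)"
    unfolding stein using int_g[of k] int_gSS[of "k + 1"]
    by (subst Bochner_Integration.integral_diff) auto
  also have "\<dots> = (\<integral>x. g x ^ k * (x \<bullet> x) - (m \<bullet> x) * g x ^ k \<partial>gauss m 1)"
    by (simp add: inner_diff_left algebra_simps)
  also have "\<dots> = (\<integral>x. g x ^ k * (x \<bullet> x) \<partial>gauss m 1) - (\<integral>x. (m \<bullet> x) * g x ^ k \<partial>gauss m 1)"
    using int_gSS[of k] int_gS[of k m] by (subst Bochner_Integration.integral_diff) (auto simp: mult_ac)
  also have "\<dots> \<le> (\<integral>x. g x ^ k * (x \<bullet> x) \<partial>gauss m 1)"
    using int_gS[of k m] g_pos
    by (simp add: gauss_integral_inner_even_nonneg mult_ac g_def less_imp_le)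
  also have "\<dots> \<le> (\<integral>x. g x ^ (k - 1) \<partial>gauss m 1)"
    using k gS[of _ "k - 1"] int_gSS[of k] int_g[of "k - 1"] by (intro integral_mono) auto
  finally have "real CARD('n) * (\<integral>x. g x ^ k \<partial>gauss m 1)
      \<le> (\<integral>x. g x ^ (k - 1) \<partial>gauss m 1) + 2 * real k * (\<integral>x. g x ^ (k + 1) * (x \<bullet> x) \<partial>gauss m 1)"
    by simp
  also have "\<dots> \<le> (\<integral>x. g x ^ (k - 1) \<partial>gauss m 1) + 2 * real k * (\<integral>x. g x ^ k \<partial>gauss m 1)"
    using gS[of _ k] int_gSS[of "k + 1"] int_g[of k] by (intro add_left_mono mult_left_mono integral_mono) auto
  finally show ?thesis
    by (simp add: algebra_simps)
qed

text \<open>Iterating the regularized step gives the bound \<open>B k\<close>, which does not depend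
  on \<epsilon>; 2 k < n makes all its factors positive. Fatou's lemma along \<epsilon> = 1 / (i +
  1) transfers the bound to the limit.\<close>

lemma integrable_inverse_norm_power:
  fixes m :: "real ^ 'n"
  assumes dim: "2 * k < CARD('n)" "2 \<le> CARD('n)"
  shows "integrable (gauss m 1) (\<lambda>x. (1 / (norm x)\<^sup>2) ^ k)"
proof -
  interpret prob_space "gauss m 1" by (rule prob_space_gauss) simp
  define g where "g \<epsilon> x = 1 / ((norm x)\<^sup>2 + \<epsilon>)" for \<epsilon> and x :: "real ^ 'n"
  have [measurable]: "g \<epsilon> \<in> borel_measurable borel" for \<epsilon>
    unfolding g_def by measurable
  define B where "B l = (\<Prod>i\<in>{1..l}. 1 / (real CARD('n) - 2 * real i))" for l
  have bound: "(\<integral>x. g \<epsilon> x ^ l \<partial>gauss m 1) \<le> B l" if \<epsilon>: "0 < \<epsilon>" and "2 * l < CARD('n)" for \<epsilon> l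
    using that(2)
  proof (induction l)
    case (Suc l)
    have p: "0 < real CARD('n) - 2 * real (Suc l)"
      using Suc.prems by linarith
    have "(real CARD('n) - 2 * real (Suc l)) * (\<integral>x. g \<epsilon> x ^ Suc l \<partial>gauss m 1) \<le> (\<integral>x. g \<epsilon> x ^ l \<partial>gauss m 1)"
      using inverse_norm_regularized_moment_step[OF \<epsilon> dim(2), of "Suc l" m] by (simp add: g_def)
    also have "\<dots> \<le> B l" using Suc by simp
    finally have "(\<integral>x. g \<epsilon> x ^ Suc l \<partial>gauss m 1) \<le> B l / (real CARD('n) - 2 * real (Suc l))"
      using p by (simp add: pos_le_divide_eq mult.commute)
    also have "\<dots> = B (Suc l)"
      by (simp add: B_def)
    finally show ?case .
  qed (simp add: B_def prob_space)
  define f where "f i x = g (1 / real (Suc i)) x ^ k" for i x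
  have f_int: "integrable (gauss m 1) (f i)" for i
  proof (rule integrable_const_bound)
    show "AE x in gauss m 1. norm (f i x) \<le> real (Suc i) ^ k"
    proof (rule AE_I2)
      fix x
      have "g (1 / real (Suc i)) x \<le> 1 / (1 / real (Suc i))"
      proof -
        have "0 < (norm x)\<^sup>2 + 1 / real (Suc i)"
          by (rule add_nonneg_pos) simp_all
        then show ?thesis
          unfolding g_def by (intro divide_left_mono mult_pos_pos) auto
      qed
      then have "f i x \<le> real (Suc i) ^ k"
        unfolding f_def by (intro power_mono) (auto simp: g_def)
      then show "norm (f i x) \<le> real (Suc i) ^ k"
        by (simp add: f_def g_def)
    qed
  qed (simp add: f_def[abs_def])
  have f_mono: "f i x \<le> f (Suc i) x" if "x \<noteq> 0" for i x
  proof -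
    have pos: "0 < (norm x)\<^sup>2 + 1 / real (Suc j)" for j
      using that by (intro add_pos_pos) auto
    have "(norm x)\<^sup>2 + 1 / real (Suc (Suc i)) \<le> (norm x)\<^sup>2 + 1 / real (Suc i)"
      by (simp add: frac_le)
    then have "g (1 / real (Suc i)) x \<le> g (1 / real (Suc (Suc i))) x"
      unfolding g_def using pos[of i] pos[of "Suc i"] by (intro divide_left_mono mult_pos_pos) simp_all
    then show ?thesis
      unfolding f_def by (intro power_mono) (simp_all add: g_def)
  qed
  have f_lim: "(\<lambda>i. f i x) \<longlonglongrightarrow> (1 / (norm x)\<^sup>2) ^ k" if "x \<noteq> 0" for x
  proof -
    have "(\<lambda>i. (1 / ((norm x)\<^sup>2 + inverse (real (Suc i)))) ^ k) \<longlonglongrightarrow> (1 / ((norm x)\<^sup>2 + 0)) ^ k"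
      using that by (intro tendsto_intros LIMSEQ_inverse_real_of_nat) auto
    then show ?thesis
      by (simp add: f_def g_def inverse_eq_divide)
  qed
  have f_nn: "0 \<le> f i x" for i x
    by (simp add: f_def g_def)
  have "(\<integral>\<^sup>+x. (1 / (norm x)\<^sup>2) ^ k \<partial>gauss m 1) \<le> ennreal (B k)"
  proof -
    have "(\<integral>\<^sup>+x. (1 / (norm x)\<^sup>2) ^ k \<partial>gauss m 1) = (\<integral>\<^sup>+x. liminf (\<lambda>i. ennreal (f i x)) \<partial>gauss m 1)"
    proof (rule nn_integral_cong_AE)
      show "AE x in gauss m 1. ennreal ((1 / (norm x)\<^sup>2) ^ k) = liminf (\<lambda>i. ennreal (f i x))"
        using AE_gauss_nonzero
      proof eventually_elim
        case (elim x)
        have "(\<lambda>i. ennreal (f i x)) \<longlonglongrightarrow> ennreal ((1 / (norm x)\<^sup>2) ^ k)"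
          using f_lim[OF elim] by (rule tendsto_ennrealI)
        then show ?case
          by (rule lim_imp_Liminf[OF sequentially_bot, symmetric])
      qed
    qed
    also have "\<dots> \<le> liminf (\<lambda>i. \<integral>\<^sup>+x. ennreal (f i x) \<partial>gauss m 1)"
      by (rule nn_integral_liminf) (simp add: f_def)
    also have "\<dots> \<le> liminf (\<lambda>i::nat. ennreal (B k))"
    proof (rule Liminf_mono, rule always_eventually, rule allI)
      fix i
      have "(\<integral>\<^sup>+x. ennreal (f i x) \<partial>gauss m 1) = ennreal (\<integral>x. f i x \<partial>gauss m 1)"
        using f_int f_nn by (intro nn_integral_eq_integral) auto
      also have "\<dots> \<le> ennreal (B k)"
        unfolding f_def using bound[OF _ dim(1)] by (intro ennreal_leI) simp
      finally show "(\<integral>\<^sup>+x. ennreal (f i x) \<partial>gauss m 1) \<le> ennreal (B k)" .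
    qed
    finally show ?thesis
      by (simp add: Liminf_const)
  qed
  then show ?thesis
    by (intro integrableI_nonneg) (auto simp: le_less_trans)
qed

section \<open>Stein's identity for powers of the inverse squared norm\<close>

text \<open>Division by zero gives the value 0 at the origin. With this value the decomposition
  \<open>js_loss_eq\<close> of the loss holds at every point and not just almost everywhere.\<close>

definition inv_sq :: "real ^ 'n \<Rightarrow> real" where
  "inv_sq x = 1 / (norm x)\<^sup>2"

lemma pole_growth_inv_sq: "pole_growth 2 inv_sq"
  by (rule pole_growthI[of _ 1 0]) (auto simp: inv_sq_def[abs_def])

lemmas borel_measurable_inv_sq [measurable] = pole_growth_measurable[OF pole_growth_inv_sq]

lemma inv_sq_nonneg [simp]: "0 \<le> inv_sq x"
  by (simp add: inv_sq_def)

lemma inv_sq_inner_self: "x \<noteq> 0 \<Longrightarrow> inv_sq x * (x \<bullet> x) = 1"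
  by (simp add: inv_sq_def power2_norm_eq_inner)

lemma has_derivative_inv_sq_power:
  assumes "x \<noteq> 0"
  shows "((\<lambda>x. inv_sq x ^ k) has_derivative (\<lambda>w. - (2 * real k * inv_sq x ^ (k + 1)) * (x \<bullet> w))) (at x)"
proof -
  have nz: "x \<bullet> x \<noteq> 0" using assms by simp
  have "((\<lambda>x. x \<bullet> x) has_derivative (\<lambda>w. 2 * (x \<bullet> w))) (at x)"
    by (auto intro!: derivative_eq_intros simp: inner_commute)
  from Deriv.has_derivative_inverse[OF nz this]
  have "(inv_sq has_derivative (\<lambda>w. - 2 * (inv_sq x)\<^sup>2 * (x \<bullet> w))) (at x)"
    unfolding inv_sq_def[abs_def] power2_norm_eq_inner
    by (simp add: inverse_eq_divide power2_eq_square)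
  then show ?thesis
    by (rule has_derivative_eq_rhs[OF has_derivative_power])
       (cases k; auto simp: fun_eq_iff power2_eq_square mult_ac)
qed

text \<open>Inside the unit ball the function is dominated by a multiple of
  \<open>inv_sq x ^ 4\<close>, which is integrable as 8 < n; outside it the denominator is at least
  1 and polynomial moments suffice. Order 8 is what \<open>stein_inv_sq\<close> requires for k =
  3.\<close>

lemma integrable_gauss_pole_growth:
  fixes f :: "real ^ 'n \<Rightarrow> real"
  assumes f: "pole_growth j f" and j: "j \<le> 8" and dim: "10 \<le> CARD('n)"
  shows "integrable (gauss m 1) f"
proof -
  obtain C k where C: "0 \<le> C" "\<And>x. x \<noteq> 0 \<Longrightarrow> norm (f x) \<le> C * (1 + norm x) ^ k / norm x ^ 8"
    using pole_growth_mono[OF f j] by (auto simp: pole_growth_def)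
  obtain D l where D: "0 \<le> D" "\<And>x. x \<noteq> 0 \<Longrightarrow> norm (f x) \<le> D * (1 + norm x) ^ l / norm x ^ j"
    using f by (auto simp: pole_growth_def)
  have inv: "inv_sq x ^ 4 = 1 / norm x ^ 8" for x :: "real ^ 'n"
    by (simp add: inv_sq_def power_one_over flip: power_mult)
  show ?thesis
  proof (rule Bochner_Integration.integrable_bound)
    show "integrable (gauss m 1) (\<lambda>x. D * (1 + norm x) ^ l + C * 2 ^ k * inv_sq x ^ 4)"
      using dim integrable_gauss_norm_power[of 1 m l] integrable_inverse_norm_power[of 4 m]
      by (simp add: inv_sq_def[abs_def])
    show "f \<in> borel_measurable (gauss m 1)"
      using pole_growth_measurable[OF f] by simp
    show "AE x in gauss m 1. norm (f x) \<le> norm (D * (1 + norm x) ^ l + C * 2 ^ k * inv_sq x ^ 4)"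
      using AE_gauss_nonzero
    proof eventually_elim
      case (elim x)
      have nn: "0 \<le> D * (1 + norm x) ^ l" "0 \<le> C * 2 ^ k * inv_sq x ^ 4"
        using C(1) D(1) by simp_all
      have "norm (f x) \<le> D * (1 + norm x) ^ l + C * 2 ^ k * inv_sq x ^ 4"
      proof (cases "norm x \<le> 1")
        case True
        have "norm (f x) \<le> C * (1 + norm x) ^ k / norm x ^ 8" by (rule C(2)[OF elim])
        also have "\<dots> \<le> C * 2 ^ k / norm x ^ 8"
          using True C(1) by (intro divide_right_mono mult_left_mono power_mono) auto
        finally show ?thesis
          using nn(1) by (simp add: inv)
      next
        case False
        have "norm (f x) \<le> D * (1 + norm x) ^ l / norm x ^ j" by (rule D(2)[OF elim])
        also have "\<dots> \<le> D * (1 + norm x) ^ l / 1"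
          using False nn(1) elim by (intro divide_left_mono one_le_power) auto
        finally show ?thesis
          using nn(2) by simp
      qed
      then show ?case
        using nn by simp
    qed
  qed
qed

text \<open>The form in which Stein's identity is applied from here on: the smooth factor
  \<open>f\<close> is polynomial in all uses, and the gradient of \<open>inv_sq x ^ k\<close> raises
  the power of \<open>inv_sq\<close> by one and contributes a factor x.\<close>

lemma stein_inv_sq:
  fixes m c :: "real ^ 'n"
  assumes dim: "10 \<le> CARD('n)" and k: "k \<le> 3"
    and deriv: "\<And>x. (f has_derivative (\<lambda>w. g x \<bullet> w)) (at x)"
    and f: "pole_growth 0 f" and g: "pole_growth 0 g"
  shows "(\<integral>x. ((x - m) \<bullet> (\<alpha> *\<^sub>R x + c)) * (f x * inv_sq x ^ k) \<partial>gauss m 1)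
       = (\<integral>x. \<alpha> * real CARD('n) * (f x * inv_sq x ^ k) + (g x \<bullet> (\<alpha> *\<^sub>R x + c)) * inv_sq x ^ k
             - 2 * real k * (f x * (x \<bullet> (\<alpha> *\<^sub>R x + c)) * inv_sq x ^ (k + 1)) \<partial>gauss m 1)"
proof -
  define G where "G x = inv_sq x ^ k *\<^sub>R g x - (2 * real k * (f x * inv_sq x ^ (k + 1))) *\<^sub>R x" for x
  note intros = pole_growth_inv_sq f g pole_growth_intros
  have h: "pole_growth (0 + k * 2) (\<lambda>x. f x * inv_sq x ^ k)"
    by (rule intros)+
  have G: "pole_growth (max (k * 2 + 0) (0 + (0 + (k + 1) * 2) + 0)) G"
    unfolding G_def by (rule intros)+
  have sq: "pole_growth (2 * max 0 0) (\<lambda>x::real^'n. (1 + norm x)\<^sup>2)"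
    by (rule intros)+
  have "(\<integral>x. ((x - m) \<bullet> (\<alpha> *\<^sub>R x + c)) * (f x * inv_sq x ^ k) \<partial>gauss m 1)
      = 1 * (\<integral>x. \<alpha> * real CARD('n) * (f x * inv_sq x ^ k) + G x \<bullet> (\<alpha> *\<^sub>R x + c) \<partial>gauss m 1)"
  proof (rule stein_field)
    show "integrable (gauss m 1) (\<lambda>x. (1 + norm x)\<^sup>2 * \<bar>f x * inv_sq x ^ k\<bar>)"
      using pole_growth_mult[OF sq pole_growth_norm[OF h]] dim k
      by (intro integrable_gauss_pole_growth) auto
    show "integrable (gauss m 1) (\<lambda>x. (1 + norm x)\<^sup>2 * norm (G x))"
      using pole_growth_mult[OF sq pole_growth_norm[OF G]] dim k
      by (intro integrable_gauss_pole_growth) auto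
    fix x :: "real ^ 'n" assume x: "x \<noteq> 0"
    show "((\<lambda>x. f x * inv_sq x ^ k) has_derivative (\<bullet>) (G x)) (at x)"
      by (rule has_derivative_eq_rhs[OF has_derivative_mult[OF deriv has_derivative_inv_sq_power[OF x]]])
         (simp add: fun_eq_iff G_def inner_diff_left algebra_simps)
  qed (use dim pole_growth_measurable[OF h] pole_growth_measurable[OF G] in auto)
  then show ?thesis
    by (simp add: G_def inner_diff_left algebra_simps)
qed

subsection \<open>Variance of the loss and of the unbiased risk estimate\<close>

lemma inner_self_inv_sq_power: "x \<noteq> 0 \<Longrightarrow> (x \<bullet> x) * inv_sq x ^ Suc k = inv_sq x ^ k"
  using inv_sq_inner_self[of x] by (simp add: mult.left_commute[of "x \<bullet> x"] mult.commute[of "x \<bullet> x"])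

section \<open>Mixed moments of the noise x - \<theta> and the inverse squared norm\<close>

context
  fixes \<theta> :: "real ^ 'n"
  assumes dim: "10 \<le> CARD('n)"
begin

definition noise_inner :: "real ^ 'n \<Rightarrow> real" where "noise_inner x = (x - \<theta>) \<bullet> x"
definition noise_sq :: "real ^ 'n \<Rightarrow> real" where "noise_sq x = (x - \<theta>) \<bullet> (x - \<theta>)"
definition inv_moment :: "nat \<Rightarrow> real" where "inv_moment k = (\<integral>x. inv_sq x ^ k \<partial>gauss \<theta> 1)"
definition inner_inv_moment :: "nat \<Rightarrow> real" where "inner_inv_moment k = (\<integral>x. (\<theta> \<bullet> x) * inv_sq x ^ k \<partial>gauss \<theta> 1)"

interpretation prob_space "gauss \<theta> 1"
  by (rule prob_space_gauss) simp

lemma prob_UNIV [simp]: "measure (gauss \<theta> 1) UNIV = 1"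
  using prob_space by simp

lemma pole_growth_noise_inner: "pole_growth 0 noise_inner"
proof -
  have "pole_growth (max 0 0 + 0) noise_inner"
    unfolding noise_inner_def[abs_def] by (rule pole_growth_intros)+
  then show ?thesis by simp
qed

lemma pole_growth_noise_sq: "pole_growth 0 noise_sq"
proof -
  have "pole_growth (max 0 0 + max 0 0) noise_sq"
    unfolding noise_sq_def[abs_def] by (rule pole_growth_intros)+
  then show ?thesis by simp
qed

lemmas pole_intros = pole_growth_noise_inner pole_growth_noise_sq pole_growth_inv_sq pole_growth_intros

lemma measurable_noise [measurable]: "noise_inner \<in> borel_measurable borel" "noise_sq \<in> borel_measurable borel"
  using pole_growth_measurable[OF pole_growth_noise_inner] pole_growth_measurable[OF pole_growth_noise_sq] by auto

lemma integrable_noise: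
  assumes "k \<le> 4"
  shows "integrable (gauss \<theta> 1) (\<lambda>x. (noise_sq x ^ a * noise_inner x ^ b) * inv_sq x ^ k)"
proof (rule integrable_gauss_pole_growth)
  show "pole_growth (a * 0 + b * 0 + k * 2) (\<lambda>x. (noise_sq x ^ a * noise_inner x ^ b) * inv_sq x ^ k)"
    by (rule pole_intros)+
qed (use assms dim in auto)

lemma integrable_inner_inv_sq:
  assumes "k \<le> 4"
  shows "integrable (gauss \<theta> 1) (\<lambda>x. (\<theta> \<bullet> x) * inv_sq x ^ k)"
proof (rule integrable_gauss_pole_growth)
  show "pole_growth (0 + 0 + k * 2) (\<lambda>x. (\<theta> \<bullet> x) * inv_sq x ^ k)"
    by (rule pole_intros)+
qed (use assms dim in auto)

lemma integrable_noise_simps: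
  "integrable (gauss \<theta> 1) noise_sq" "integrable (gauss \<theta> 1) (\<lambda>x. (noise_sq x)\<^sup>2)"
  "integrable (gauss \<theta> 1) noise_inner"
  "k \<le> 4 \<Longrightarrow> integrable (gauss \<theta> 1) (\<lambda>x. inv_sq x ^ k)"
  "integrable (gauss \<theta> 1) (\<lambda>x. inv_sq x)"
  "integrable (gauss \<theta> 1) (\<lambda>x. noise_sq x * inv_sq x)"
  "integrable (gauss \<theta> 1) (\<lambda>x. noise_inner x * inv_sq x)"
  "k \<le> 4 \<Longrightarrow> integrable (gauss \<theta> 1) (\<lambda>x. noise_inner x * inv_sq x ^ k)"
  "integrable (gauss \<theta> 1) (\<lambda>x. noise_sq x * noise_inner x * inv_sq x)"
  "k \<le> 4 \<Longrightarrow> integrable (gauss \<theta> 1) (\<lambda>x. (noise_inner x)\<^sup>2 * inv_sq x ^ k)"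
  using integrable_noise[of 0 1 0] integrable_noise[of 0 2 0] integrable_noise[of 0 0 1] integrable_noise[of k 0 0]
    integrable_noise[of 1 0 0] integrable_noise[of 1 1 0] integrable_noise[of 1 0 1] integrable_noise[of k 0 1]
    integrable_noise[of 1 1 1] integrable_noise[of k 0 2] by auto

lemma has_derivative_noise_inner: "(noise_inner has_derivative (\<lambda>w. (2 *\<^sub>R x - \<theta>) \<bullet> w)) (at x)"
  unfolding noise_inner_def[abs_def]
  by (auto intro!: derivative_eq_intros simp: fun_eq_iff inner_commute algebra_simps)

lemma has_derivative_noise_sq: "(noise_sq has_derivative (\<lambda>w. (2 *\<^sub>R (x - \<theta>)) \<bullet> w)) (at x)"
  unfolding noise_sq_def[abs_def]
  by (auto intro!: derivative_eq_intros simp: fun_eq_iff inner_commute algebra_simps)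

lemma has_derivative_one: "((\<lambda>x. 1::real) has_derivative (\<lambda>w. (0::real^'n) \<bullet> w)) (at x)"
  by simp

lemma pole_growth_gradients: "pole_growth 0 (\<lambda>x::real^'n. 2 *\<^sub>R x - \<theta>)" "pole_growth 0 (\<lambda>x. 2 *\<^sub>R (x - \<theta>))"
proof -
  have "pole_growth (max (0 + 0) 0) (\<lambda>x::real^'n. 2 *\<^sub>R x - \<theta>)" "pole_growth (0 + max 0 0) (\<lambda>x. 2 *\<^sub>R (x - \<theta>))"
    by (rule pole_intros)+
  then show "pole_growth 0 (\<lambda>x::real^'n. 2 *\<^sub>R x - \<theta>)" "pole_growth 0 (\<lambda>x. 2 *\<^sub>R (x - \<theta>))"
    by simp_all
qed

lemma expectation_noise_sq: "(\<integral>x. noise_sq x \<partial>gauss \<theta> 1) = real CARD('n)"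
  using stein_inv_sq[OF dim _ has_derivative_one pole_growth_const pole_growth_const, of 0 \<theta> 1 "- \<theta>"]
  by (simp add: noise_sq_def prob_space)

lemma expectation_noise_sq_sq: "(\<integral>x. (noise_sq x)\<^sup>2 \<partial>gauss \<theta> 1) = real CARD('n) * (real CARD('n) + 2)"
proof -
  have "(\<integral>x. (noise_sq x)\<^sup>2 \<partial>gauss \<theta> 1) = (\<integral>x. (real CARD('n) + 2) * noise_sq x \<partial>gauss \<theta> 1)"
    using stein_inv_sq[OF dim _ has_derivative_noise_sq pole_growth_noise_sq pole_growth_gradients(2), of 0 \<theta> 1 "- \<theta>"]
    by (simp add: noise_sq_def power2_eq_square algebra_simps)
  then show ?thesis
    by (simp add: expectation_noise_sq)
qed

text \<open>Off the origin the field \<open>inv_sq x ^ k *\<^sub>R x\<close> has divergence (n - 2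
  k) \<open>inv_sq x ^ k\<close>.\<close>

lemma expectation_noise_inner_inv_sq:
  assumes "k \<le> 3"
  shows "(\<integral>x. noise_inner x * inv_sq x ^ k \<partial>gauss \<theta> 1) = (real CARD('n) - 2 * real k) * inv_moment k"
proof -
  have "(\<integral>x. noise_inner x * inv_sq x ^ k \<partial>gauss \<theta> 1)
      = (\<integral>x. real CARD('n) * inv_sq x ^ k - 2 * real k * ((x \<bullet> x) * inv_sq x ^ (k + 1)) \<partial>gauss \<theta> 1)"
    using stein_inv_sq[OF dim assms has_derivative_one pole_growth_const pole_growth_const, of \<theta> 1 0]
    by (simp add: noise_inner_def)
  also have "\<dots> = (\<integral>x. (real CARD('n) - 2 * real k) * inv_sq x ^ k \<partial>gauss \<theta> 1)"
  proof (rule integral_cong_AE)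
    show "AE x in gauss \<theta> 1. real CARD('n) * inv_sq x ^ k - 2 * real k * ((x \<bullet> x) * inv_sq x ^ (k + 1))
        = (real CARD('n) - 2 * real k) * inv_sq x ^ k"
      using AE_gauss_nonzero
    proof eventually_elim
      case (elim x)
      from inner_self_inv_sq_power[OF this, of k] show ?case
        by (simp add: left_diff_distrib)
    qed
  qed measurable
  finally show ?thesis
    by (simp add: inv_moment_def)
qed

text \<open>Stein's identity for the constant field \<theta>, which has no divergence, so that only
  the gradient of \<open>inv_sq x ^ k\<close> contributes. This relation later eliminates the
  moments containing \<theta> \<bullet> x.\<close>

lemma expectation_inner_inv_sq:
  assumes "k \<le> 2"
  shows "inner_inv_moment k - (\<theta> \<bullet> \<theta>) * inv_moment k = - (2 * real k * inner_inv_moment (k + 1))"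
proof -
  have "(\<integral>x. ((x - \<theta>) \<bullet> \<theta>) * inv_sq x ^ k \<partial>gauss \<theta> 1) = - (2 * real k * inner_inv_moment (k + 1))"
    using stein_inv_sq[OF dim _ has_derivative_one pole_growth_const pole_growth_const, of k \<theta> 0 \<theta>] assms
    by (simp add: inner_inv_moment_def inner_commute)
  moreover have "(\<integral>x. ((x - \<theta>) \<bullet> \<theta>) * inv_sq x ^ k \<partial>gauss \<theta> 1)
      = (\<integral>x. (\<theta> \<bullet> x) * inv_sq x ^ k - (\<theta> \<bullet> \<theta>) * inv_sq x ^ k \<partial>gauss \<theta> 1)"
    by (simp add: algebra_simps inner_commute)
  moreover have "\<dots> = inner_inv_moment k - (\<theta> \<bullet> \<theta>) * inv_moment k"
    using assms integrable_inner_inv_sq[of k] integrable_noise_simps(4)[of k]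
    by (subst Bochner_Integration.integral_diff) (auto simp: inner_inv_moment_def inv_moment_def)
  ultimately show ?thesis
    by simp
qed

text \<open>A direct evaluation by (x - \<theta>) \<bullet> x = x \<bullet> x - \<theta> \<bullet>
  x. Comparison with the value from Stein's identity gives the recurrence
  \<open>inv_moment_step\<close>.\<close>

lemma expectation_noise_inner_inv_sq':
  assumes "k \<le> 3"
  shows "(\<integral>x. noise_inner x * inv_sq x ^ Suc k \<partial>gauss \<theta> 1) = inv_moment k - inner_inv_moment (Suc k)"
proof -
  have "(\<integral>x. noise_inner x * inv_sq x ^ Suc k \<partial>gauss \<theta> 1)
      = (\<integral>x. inv_sq x ^ k - (\<theta> \<bullet> x) * inv_sq x ^ Suc k \<partial>gauss \<theta> 1)"
  proof (rule integral_cong_AE)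
    show "AE x in gauss \<theta> 1. noise_inner x * inv_sq x ^ Suc k = inv_sq x ^ k - (\<theta> \<bullet> x) * inv_sq x ^ Suc k"
      using AE_gauss_nonzero
    proof eventually_elim
      case (elim x)
      from inner_self_inv_sq_power[OF this, of k] show ?case
        by (simp add: noise_inner_def inner_diff_left left_diff_distrib)
    qed
  qed measurable
  also have "\<dots> = inv_moment k - inner_inv_moment (Suc k)"
    using assms integrable_inner_inv_sq[of "Suc k"] integrable_noise_simps(4)[of k]
    by (subst Bochner_Integration.integral_diff) (auto simp: inner_inv_moment_def inv_moment_def)
  finally show ?thesis .
qed

lemma expectation_noise_sq_inv_sq:
  "(\<integral>x. noise_sq x * inv_sq x \<partial>gauss \<theta> 1) = real CARD('n) * inv_moment 1 - 2 * (real CARD('n) - 4) * inv_moment 2"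
proof -
  have "(\<integral>x. noise_sq x * inv_sq x \<partial>gauss \<theta> 1)
      = (\<integral>x. real CARD('n) * inv_sq x ^ 1 - 2 * (noise_inner x * inv_sq x ^ 2) \<partial>gauss \<theta> 1)"
    using stein_inv_sq[OF dim _ has_derivative_one pole_growth_const pole_growth_const, of 1 \<theta> 1 "- \<theta>"]
    by (simp add: noise_sq_def noise_inner_def inner_commute power2_eq_square)
  also have "\<dots> = real CARD('n) * inv_moment 1 - 2 * (real CARD('n) - 4) * inv_moment 2"
    using integrable_noise_simps(4)[of 1] integrable_noise_simps(8)[of 2] expectation_noise_inner_inv_sq[of 2]
    by (subst Bochner_Integration.integral_diff) (auto simp: inv_moment_def)
  finally show ?thesis .
qed

text \<open>One factor \<open>noise_inner\<close> is kept as the smooth factor and the other comes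
  from the field x. Every x \<bullet> x that arises cancels a factor \<open>inv_sq\<close>, which
  leaves only moments at most linear in the noise.\<close>

lemma expectation_noise_inner_sq_inv_sq:
  "(\<integral>x. (noise_inner x)\<^sup>2 * (inv_sq x)\<^sup>2 \<partial>gauss \<theta> 1) = inv_moment 1 + (real CARD('n) - 3) * (real CARD('n) - 4) * inv_moment 2"
proof -
  have "(\<integral>x. (noise_inner x)\<^sup>2 * (inv_sq x)\<^sup>2 \<partial>gauss \<theta> 1)
      = (\<integral>x. real CARD('n) * (noise_inner x * inv_sq x ^ 2) + ((2 *\<^sub>R x - \<theta>) \<bullet> x) * inv_sq x ^ 2
            - 4 * (noise_inner x * (x \<bullet> x) * inv_sq x ^ 3) \<partial>gauss \<theta> 1)"
    using stein_inv_sq[OF dim _ has_derivative_noise_inner pole_growth_noise_inner pole_growth_gradients(1), of 2 \<theta> 1 0]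
    by (simp add: noise_inner_def power2_eq_square mult_ac)
  also have "\<dots> = (\<integral>x. inv_sq x ^ 1 + (real CARD('n) - 3) * (noise_inner x * inv_sq x ^ 2) \<partial>gauss \<theta> 1)"
  proof (rule integral_cong_AE)
    show "AE x in gauss \<theta> 1. real CARD('n) * (noise_inner x * inv_sq x ^ 2) + ((2 *\<^sub>R x - \<theta>) \<bullet> x) * inv_sq x ^ 2
            - 4 * (noise_inner x * (x \<bullet> x) * inv_sq x ^ 3) = inv_sq x ^ 1 + (real CARD('n) - 3) * (noise_inner x * inv_sq x ^ 2)"
      using AE_gauss_nonzero
    proof eventually_elim
      case (elim x)
      define s where "s = x \<bullet> x"
      have i: "inv_sq x * s = 1" unfolding s_def by (rule inv_sq_inner_self[OF elim])
      have g: "(2 *\<^sub>R x - \<theta>) \<bullet> x = s + noise_inner x"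
        by (simp add: noise_inner_def s_def algebra_simps)
      have "noise_inner x * s * inv_sq x ^ 3 = noise_inner x * inv_sq x ^ 2 * (inv_sq x * s)"
        by (simp add: power3_eq_cube power2_eq_square)
      then have a: "noise_inner x * s * inv_sq x ^ 3 = noise_inner x * inv_sq x ^ 2"
        unfolding i by simp
      have "s * inv_sq x ^ 2 = inv_sq x * (inv_sq x * s)"
        by (simp add: power2_eq_square)
      then have b: "s * inv_sq x ^ 2 = inv_sq x"
        unfolding i by simp
      show ?case
        unfolding g s_def[symmetric] distrib_right left_diff_distrib a b by simp
    qed
  qed measurable
  also have "\<dots> = inv_moment 1 + (real CARD('n) - 3) * ((real CARD('n) - 4) * inv_moment 2)"
    using integrable_noise_simps(4)[of 1] integrable_noise_simps(8)[of 2] expectation_noise_inner_inv_sq[of 2]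
    by (subst Bochner_Integration.integral_add) (auto simp: inv_moment_def)
  finally show ?thesis by simp
qed

text \<open>Here \<open>noise_inner\<close> is the smooth factor and x - \<theta> the field; the
  pairing of the gradient 2 x - \<theta> with the field is
  \<open>noise_inner x + noise_sq x\<close>.\<close>

lemma expectation_noise_sq_inner_inv_sq:
  "(\<integral>x. noise_sq x * noise_inner x * inv_sq x \<partial>gauss \<theta> 1)
   = (real CARD('n) + 1) * (\<integral>x. noise_inner x * inv_sq x \<partial>gauss \<theta> 1) + (\<integral>x. noise_sq x * inv_sq x \<partial>gauss \<theta> 1)
     - 2 * (\<integral>x. (noise_inner x)\<^sup>2 * (inv_sq x)\<^sup>2 \<partial>gauss \<theta> 1)"
proof -
  have g: "(2 *\<^sub>R x - \<theta>) \<bullet> (x - \<theta>) = noise_inner x + noise_sq x" "x \<bullet> (x - \<theta>) = noise_inner x" for x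
    by (simp_all add: noise_inner_def noise_sq_def algebra_simps inner_commute)
  have "(\<integral>x. noise_sq x * noise_inner x * inv_sq x \<partial>gauss \<theta> 1)
      = (\<integral>x. real CARD('n) * (noise_inner x * inv_sq x) + (noise_inner x + noise_sq x) * inv_sq x - 2 * (noise_inner x * noise_inner x * (inv_sq x)\<^sup>2) \<partial>gauss \<theta> 1)"
    using stein_inv_sq[OF dim _ has_derivative_noise_inner pole_growth_noise_inner pole_growth_gradients(1), of 1 \<theta> 1 "- \<theta>"]
    by (simp add: noise_sq_def[symmetric] g mult.assoc power2_eq_square)
  also have "\<dots> = (\<integral>x. (real CARD('n) + 1) * (noise_inner x * inv_sq x) + noise_sq x * inv_sq x - 2 * ((noise_inner x)\<^sup>2 * (inv_sq x)\<^sup>2) \<partial>gauss \<theta> 1)"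
    by (simp add: algebra_simps power2_eq_square)
  also have "\<dots> = (real CARD('n) + 1) * (\<integral>x. noise_inner x * inv_sq x \<partial>gauss \<theta> 1) + (\<integral>x. noise_sq x * inv_sq x \<partial>gauss \<theta> 1)
     - 2 * (\<integral>x. (noise_inner x)\<^sup>2 * (inv_sq x)\<^sup>2 \<partial>gauss \<theta> 1)"
    using integrable_noise_simps(6,7) integrable_noise_simps(10)[of 2] by simp
  finally show ?thesis .
qed

section \<open>Recurrences and inequalities for the inverse moments\<close>

lemma inner_inv_sq_nonneg: "k \<le> 4 \<Longrightarrow> 0 \<le> inner_inv_moment k"
  unfolding inner_inv_moment_def using integrable_inner_inv_sq[of k]
  by (intro gauss_integral_inner_even_nonneg) (simp_all, simp add: inv_sq_def)

lemma inv_moment_0: "inv_moment 0 = 1"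
  by (simp add: inv_moment_def)

lemma inv_moment_step:
  assumes "k \<le> 2"
  shows "(real CARD('n) - 2 * real (Suc k)) * inv_moment (Suc k) = inv_moment k - inner_inv_moment (Suc k)"
  using expectation_noise_inner_inv_sq[of "Suc k"] expectation_noise_inner_inv_sq'[of k] assms by simp

lemma inv_moment_1_le: "(real CARD('n) - 2) * inv_moment 1 \<le> 1"
  using inv_moment_step[of 0] inner_inv_sq_nonneg[of 1] by (simp add: inv_moment_0)

lemma inv_moment_2_le: "(real CARD('n) - 4) * inv_moment 2 \<le> inv_moment 1"
  using inv_moment_step[of 1] inner_inv_sq_nonneg[of 2] by (simp add: numeral_2_eq_2)

lemma inv_moment_nonneg: "0 \<le> inv_moment k"
  by (simp add: inv_moment_def)

text \<open>Two instances of \<open>inv_moment_step\<close> and one of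
  \<open>expectation_inner_inv_sq\<close> are three equations; eliminating both moments with
  \<theta> \<bullet> x leaves a relation between inverse moments alone. The second identity is the
  same elimination one order higher.\<close>

lemma inv_moment_identity_1:
  "(real CARD('n) - 4 + \<theta> \<bullet> \<theta>) * inv_moment 1 + 2 * (real CARD('n) - 4) * inv_moment 2 = 1"
proof -
  have "(real CARD('n) - 2) * inv_moment 1 = 1 - inner_inv_moment 1" "(real CARD('n) - 4) * inv_moment 2 = inv_moment 1 - inner_inv_moment 2"
    using inv_moment_step[of 0] inv_moment_step[of 1] by (simp_all add: inv_moment_0 numeral_2_eq_2)
  moreover have "inner_inv_moment 1 - (\<theta> \<bullet> \<theta>) * inv_moment 1 = - (2 * inner_inv_moment 2)"
    using expectation_inner_inv_sq[of 1] by (simp add: numeral_2_eq_2)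
  ultimately show ?thesis
    by (simp add: algebra_simps)
qed

lemma inv_moment_identity_2:
  "(real CARD('n) - 8 + \<theta> \<bullet> \<theta>) * inv_moment 2 + 4 * (real CARD('n) - 6) * inv_moment 3 = inv_moment 1"
proof -
  have "(real CARD('n) - 4) * inv_moment 2 = inv_moment 1 - inner_inv_moment 2" "(real CARD('n) - 6) * inv_moment 3 = inv_moment 2 - inner_inv_moment 3"
    using inv_moment_step[of 1] inv_moment_step[of 2] by (simp_all add: numeral_2_eq_2 numeral_3_eq_3)
  moreover have "inner_inv_moment 2 - (\<theta> \<bullet> \<theta>) * inv_moment 2 = - (4 * inner_inv_moment 3)"
    using expectation_inner_inv_sq[of 2] by (simp add: numeral_2_eq_2 numeral_3_eq_3)
  ultimately show ?thesis
    by (simp add: algebra_simps)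
qed

text \<open>A vanishing first moment would force the second to vanish, and the first identity would
  read 0 = 1.\<close>

lemma inv_moment_1_pos: "0 < inv_moment 1"
proof (rule ccontr)
  assume "\<not> 0 < inv_moment 1"
  then have p1: "inv_moment 1 = 0"
    using inv_moment_nonneg[of 1] by simp
  then have "(real CARD('n) - 4) * inv_moment 2 = 0"
    using inv_moment_2_le inv_moment_nonneg[of 2] dim
    by (intro antisym) (auto intro!: mult_nonneg_nonneg)
  with p1 inv_moment_identity_1 dim show False
    by auto
qed

text \<open>Cauchy-Schwarz for the powers 1/2 and 3/2 of \<open>inv_sq\<close>.\<close>

lemma inv_moment_log_convex: "(inv_moment 2)\<^sup>2 \<le> inv_moment 1 * inv_moment 3"
proof -
  \<comment> \<open>The minimizer of the quadratic \<open>t\<^sup>2 * inv_moment 1 - 2 * t *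
    inv_moment 2 + inv_moment 3\<close>.\<close>
  define t where "t = inv_moment 2 / inv_moment 1"
  have "0 \<le> (\<integral>x. inv_sq x * (t - inv_sq x)\<^sup>2 \<partial>gauss \<theta> 1)"
    by simp
  also have "\<dots> = (\<integral>x. t\<^sup>2 * inv_sq x ^ 1 - 2 * t * inv_sq x ^ 2 + inv_sq x ^ 3 \<partial>gauss \<theta> 1)"
    by (simp add: power2_eq_square power3_eq_cube algebra_simps)
  also have "\<dots> = t\<^sup>2 * inv_moment 1 - 2 * t * inv_moment 2 + inv_moment 3"
    using integrable_noise_simps(4)[of 1] integrable_noise_simps(4)[of 2] integrable_noise_simps(4)[of 3]
    by (simp add: inv_moment_def)
  finally have "0 \<le> (t\<^sup>2 * inv_moment 1 - 2 * t * inv_moment 2 + inv_moment 3) * inv_moment 1"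
    using inv_moment_nonneg[of 1] by simp
  also have "\<dots> = inv_moment 1 * inv_moment 3 - (inv_moment 2)\<^sup>2"
    using inv_moment_1_pos unfolding t_def by (simp add: field_simps power2_eq_square)
  finally show ?thesis by simp
qed

text \<open>In \<open>E inv_sq\<^sup>2 - (E inv_sq)\<^sup>2\<close>, multiply the first term by the left side of the first
  identity and replace one factor of the second term by the left side of the second identity:
  the terms depending on \<open>\<theta>\<close> cancel.\<close>

lemma inv_sq_variance_le:
  "(real CARD('n) - 4)\<^sup>2 * (inv_moment 2 - (inv_moment 1)\<^sup>2) \<le> 2 * real CARD('n) * (inv_moment 1)\<^sup>2"
proof -
  define n where "n = real CARD('n)"
  define b where "b = n - 4 + \<theta> \<bullet> \<theta>"
  define u where "u = (n - 4) * inv_moment 2"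
  have n: "10 \<le> n" using dim by (simp add: n_def)
  have i1: "b * inv_moment 1 + 2 * (n - 4) * inv_moment 2 = 1"
    using inv_moment_identity_1 by (simp add: n_def b_def)
  have i2: "inv_moment 1 = (b - 4) * inv_moment 2 + 4 * (n - 6) * inv_moment 3"
    using inv_moment_identity_2 by (simp add: n_def b_def algebra_simps)
  have "inv_moment 2 - (inv_moment 1)\<^sup>2 = inv_moment 2 * (b * inv_moment 1 + 2 * (n - 4) * inv_moment 2) - inv_moment 1 * ((b - 4) * inv_moment 2 + 4 * (n - 6) * inv_moment 3)"
    unfolding i1 i2[symmetric] by (simp add: power2_eq_square)
  also have "\<dots> = 4 * inv_moment 1 * inv_moment 2 + 2 * (n - 4) * (inv_moment 2)\<^sup>2 - 4 * (n - 6) * (inv_moment 1 * inv_moment 3)"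
    by (simp add: algebra_simps power2_eq_square)
  \<comment> \<open>The third moment appears with a negative coefficient, so log-convexity removes
    it in the right direction.\<close>
  also have "\<dots> \<le> 4 * inv_moment 1 * inv_moment 2 + 2 * (n - 4) * (inv_moment 2)\<^sup>2 - 4 * (n - 6) * (inv_moment 2)\<^sup>2"
    using inv_moment_log_convex n by (intro diff_left_mono mult_left_mono) auto
  finally have "(n - 4)\<^sup>2 * (inv_moment 2 - (inv_moment 1)\<^sup>2)
      \<le> (n - 4)\<^sup>2 * (4 * inv_moment 1 * inv_moment 2 + 2 * (n - 4) * (inv_moment 2)\<^sup>2 - 4 * (n - 6) * (inv_moment 2)\<^sup>2)"
    by (rule mult_left_mono) simp
  also have "\<dots> = 4 * (n - 4) * inv_moment 1 * u - 2 * (n - 8) * u\<^sup>2"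
    by (simp add: u_def power2_eq_square algebra_simps)
  \<comment> \<open>The quadratic in \<open>u\<close> is compared with its value at
    \<open>u = inv_moment 1\<close>, the upper end of the range of \<open>u\<close>. The difference
    splits into two factors that are nonnegative on this range.\<close>
  also have "\<dots> = 2 * n * (inv_moment 1)\<^sup>2 - 2 * ((inv_moment 1 - u) * (n * inv_moment 1 - (n - 8) * u))"
    by (simp add: power2_eq_square algebra_simps)
  also have "\<dots> \<le> 2 * n * (inv_moment 1)\<^sup>2"
  proof -
    have u: "u \<le> inv_moment 1" "0 \<le> u"
      using inv_moment_2_le inv_moment_nonneg[of 2] n by (simp_all add: u_def n_def)
    have "(n - 8) * u \<le> n * inv_moment 1"
      using u n by (intro mult_mono) auto
    then show ?thesis
      using u by simp
  qed
  finally show ?thesis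
    by (simp add: n_def)
qed

text \<open>Loss minus unbiased risk estimate. It has the form \<open>(x - \<theta>) \<bullet> v - div v\<close>
  with \<open>v = (x - \<theta>) - 2 (n - 2) inv_sq x x\<close>, so its mean is zero.\<close>

definition loss_gap :: "real ^ 'n \<Rightarrow> real" where
  "loss_gap x = noise_sq x - real CARD('n) - 2 * (real CARD('n) - 2) * ((noise_inner x - (real CARD('n) - 2)) * inv_sq x)"

text \<open>Expanding the square leaves exactly the mixed moments computed above. The summand 2 n is
  the variance of \<open>noise_sq\<close>, a chi-square variable with n degrees of freedom.\<close>

lemma expectation_loss_gap_sq:
  "(\<integral>x. (loss_gap x)\<^sup>2 \<partial>gauss \<theta> 1)
   = 2 * real CARD('n) + 4 * (real CARD('n) - 2)\<^sup>2 * (real CARD('n) * inv_moment 2 - inv_moment 1)"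
proof -
  define n where "n = real CARD('n)"
  define m where "m = n - 2"
  have "(loss_gap x)\<^sup>2 = (noise_sq x)\<^sup>2 - 2 * n * noise_sq x + n\<^sup>2
       - 4 * m * (noise_sq x * noise_inner x * inv_sq x) + 4 * m * n * (noise_inner x * inv_sq x) + 4 * m\<^sup>2 * (noise_sq x * inv_sq x)
       - 4 * m\<^sup>2 * n * inv_sq x
       + 4 * m\<^sup>2 * ((noise_inner x)\<^sup>2 * inv_sq x ^ 2) - 8 * m ^ 3 * (noise_inner x * inv_sq x ^ 2) + 4 * m ^ 4 * inv_sq x ^ 2" for x
    unfolding loss_gap_def n_def[symmetric] m_def[symmetric] by algebra
  then have "(\<integral>x. (loss_gap x)\<^sup>2 \<partial>gauss \<theta> 1) = n * (n + 2) - 2 * n * n + n\<^sup>2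
       - 4 * m * (\<integral>x. noise_sq x * noise_inner x * inv_sq x \<partial>gauss \<theta> 1) + 4 * m * n * (\<integral>x. noise_inner x * inv_sq x \<partial>gauss \<theta> 1)
       + 4 * m\<^sup>2 * (\<integral>x. noise_sq x * inv_sq x \<partial>gauss \<theta> 1) - 4 * m\<^sup>2 * n * inv_moment 1
       + 4 * m\<^sup>2 * (\<integral>x. (noise_inner x)\<^sup>2 * inv_sq x ^ 2 \<partial>gauss \<theta> 1)
       - 8 * m ^ 3 * (\<integral>x. noise_inner x * inv_sq x ^ 2 \<partial>gauss \<theta> 1) + 4 * m ^ 4 * inv_moment 2"
    using integrable_noise_simps(1-7) integrable_noise_simps(4,8,10)[of 2] integrable_noise_simps(9)
      expectation_noise_sq expectation_noise_sq_sq
    by (simp add: inv_moment_def n_def)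
  also have "(\<integral>x. noise_inner x * inv_sq x \<partial>gauss \<theta> 1) = m * inv_moment 1"
    using expectation_noise_inner_inv_sq[of 1] by (simp add: m_def n_def)
  also have "(\<integral>x. noise_sq x * noise_inner x * inv_sq x \<partial>gauss \<theta> 1)
     = (n + 1) * (m * inv_moment 1) + (n * inv_moment 1 - 2 * (n - 4) * inv_moment 2) - 2 * (inv_moment 1 + (n - 3) * (n - 4) * inv_moment 2)"
    unfolding expectation_noise_sq_inner_inv_sq expectation_noise_sq_inv_sq expectation_noise_inner_sq_inv_sq
    using expectation_noise_inner_inv_sq[of 1] by (simp add: m_def n_def)
  also have "(\<integral>x. noise_inner x * inv_sq x ^ 2 \<partial>gauss \<theta> 1) = (n - 4) * inv_moment 2"
    using expectation_noise_inner_inv_sq[of 2] by (simp add: n_def)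
  also have "(\<integral>x. noise_sq x * inv_sq x \<partial>gauss \<theta> 1) = n * inv_moment 1 - 2 * (n - 4) * inv_moment 2"
    unfolding expectation_noise_sq_inv_sq n_def ..
  also have "(\<integral>x. (noise_inner x)\<^sup>2 * inv_sq x ^ 2 \<partial>gauss \<theta> 1) = inv_moment 1 + (n - 3) * (n - 4) * inv_moment 2"
    unfolding expectation_noise_inner_sq_inv_sq n_def ..
  finally show ?thesis
    unfolding m_def n_def[symmetric] by algebra
qed

text \<open>From (n - 4) E inv_sq^2 \<le> E inv_sq and (n - 2) E inv_sq \<le> 1 the second summand
  is at most 16 (n - 2) / (n - 4), which is below 11 n / 5 for n \<ge> 10. Together with 2 n this
  makes 21 n / 5.\<close>

lemma expectation_loss_gap_sq_le: "(\<integral>x. (loss_gap x)\<^sup>2 \<partial>gauss \<theta> 1) \<le> 21 / 5 * real CARD('n)"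
proof -
  define n where "n = real CARD('n)"
  have n: "10 \<le> n" using dim by (simp add: n_def)
  have "(n - 4) * (n * inv_moment 2 - inv_moment 1) \<le> n * inv_moment 1 - (n - 4) * inv_moment 1"
    using inv_moment_2_le mult_left_mono[of "(n - 4) * inv_moment 2" "inv_moment 1" n] n
    by (simp add: n_def algebra_simps)
  then have "(n - 2) * ((n - 4) * (n * inv_moment 2 - inv_moment 1)) \<le> (n - 2) * (4 * inv_moment 1)"
    using n by (intro mult_left_mono) (auto simp: algebra_simps)
  also have "\<dots> \<le> 4"
    using inv_moment_1_le by (simp add: n_def)
  finally have "4 * (n - 2) * ((n - 2) * ((n - 4) * (n * inv_moment 2 - inv_moment 1))) \<le> 4 * (n - 2) * 4"
    using n by (intro mult_left_mono) auto
  also have "\<dots> \<le> 11 / 5 * n * (n - 4)"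
  proof -
    \<comment> \<open>The polynomial 11 n (n - 4) - 80 (n - 2), divided by n - 10 with
      remainder.\<close>
    have "0 \<le> (n - 10) * (11 * n - 14) + 20"
      using n by (intro add_nonneg_nonneg mult_nonneg_nonneg) auto
    then show ?thesis by (simp add: algebra_simps)
  qed
  finally have "(n - 4) * (4 * (n - 2)\<^sup>2 * (n * inv_moment 2 - inv_moment 1)) \<le> (n - 4) * (11 / 5 * n)"
    by (simp only: power2_eq_square mult_ac)
  then have "4 * (n - 2)\<^sup>2 * (n * inv_moment 2 - inv_moment 1) \<le> 11 / 5 * n"
    using n by (subst (asm) mult_le_cancel_left_pos) auto
  then show ?thesis
    unfolding expectation_loss_gap_sq n_def[symmetric] by simp
qed

lemma js_loss_eq:
  "(norm (js_est x - \<theta>))\<^sup>2 = real CARD('n) - (real CARD('n) - 2)\<^sup>2 * inv_sq x + loss_gap x"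
proof (cases "x = 0")
  case False
  define s where "s = (real CARD('n) - 2) * inv_sq x"
  have "js_est x - \<theta> = (x - \<theta>) - s *\<^sub>R x"
    by (simp add: js_est_def inv_sq_def s_def algebra_simps)
  have "(norm (z - s *\<^sub>R x))\<^sup>2 = z \<bullet> z - 2 * s * (z \<bullet> x) + s\<^sup>2 * (x \<bullet> x)" for z
    unfolding power2_norm_eq_inner
    by (simp add: inner_diff_left inner_diff_right inner_commute power2_eq_square)
  from this[of "x - \<theta>"] have "(norm (js_est x - \<theta>))\<^sup>2 = noise_sq x - 2 * s * noise_inner x + s\<^sup>2 * (x \<bullet> x)"
    unfolding \<open>js_est x - \<theta> = _\<close> noise_sq_def noise_inner_def .
  also have "s\<^sup>2 * (x \<bullet> x) = (real CARD('n) - 2)\<^sup>2 * inv_sq x"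
    using inv_sq_inner_self[OF False] by (simp add: s_def power2_eq_square)
  finally show ?thesis
    by (simp add: s_def loss_gap_def power2_eq_square algebra_simps)
qed (simp add: js_est_def noise_sq_def noise_inner_def loss_gap_def inv_sq_def power2_norm_eq_inner)

lemma integrable_loss_gap: "integrable (gauss \<theta> 1) loss_gap"
  using integrable_noise_simps(1,5,7) unfolding loss_gap_def[abs_def] by (simp add: left_diff_distrib)

lemma integrable_loss_gap_sq: "integrable (gauss \<theta> 1) (\<lambda>x. (loss_gap x)\<^sup>2)"
proof (rule integrable_gauss_pole_growth)
  show "pole_growth (2 * max (max 0 0) (0 + (max 0 0 + 2))) (\<lambda>x. (loss_gap x)\<^sup>2)"
    unfolding loss_gap_def by (rule pole_intros)+
qed (use dim in auto)

lemma expectation_loss_gap: "(\<integral>x. loss_gap x \<partial>gauss \<theta> 1) = 0"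
  using integrable_noise_simps(1,5,7) expectation_noise_sq expectation_noise_inner_inv_sq[of 1]
  unfolding loss_gap_def by (simp add: inv_moment_def left_diff_distrib)

lemma integrable_js_loss: "integrable (gauss \<theta> 1) (\<lambda>x. (norm (js_est x - \<theta>))\<^sup>2)"
  unfolding js_loss_eq using integrable_noise_simps(5) integrable_loss_gap by simp

lemma quad_risk_js: "quad_risk \<theta> js_est = real CARD('n) - (real CARD('n) - 2)\<^sup>2 * inv_moment 1"
  unfolding quad_risk_def js_loss_eq
  using integrable_noise_simps(5) integrable_loss_gap by (simp add: inv_moment_def expectation_loss_gap)

text \<open>By \<open>inv_sq_variance_le\<close> and (n - 2) E inv_sq \<le> 1 the variance is at
  most 2 n ((n - 2) / (n - 4))^2, and the squared ratio is at most 9/5 for n \<ge> 10. Here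
  \<open>U\<close> is the estimate before taking the positive part.\<close>

lemma unbiased_risk_variance:
  defines "U \<equiv> \<lambda>x. real CARD('n) - (real CARD('n) - 2)\<^sup>2 * inv_sq x"
  shows "integrable (gauss \<theta> 1) (\<lambda>x. (U x - quad_risk \<theta> js_est)\<^sup>2)"
    and "(\<integral>x. (U x - quad_risk \<theta> js_est)\<^sup>2 \<partial>gauss \<theta> 1) \<le> 18 / 5 * real CARD('n)"
proof -
  define n where "n = real CARD('n)"
  have n: "10 \<le> n" using dim by (simp add: n_def)
  have eq: "(U x - quad_risk \<theta> js_est)\<^sup>2 = (n - 2) ^ 4 * (inv_sq x ^ 2 - 2 * inv_moment 1 * inv_sq x + (inv_moment 1)\<^sup>2)" for x
    unfolding quad_risk_js U_def n_def[symmetric] by algebra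
  show "integrable (gauss \<theta> 1) (\<lambda>x. (U x - quad_risk \<theta> js_est)\<^sup>2)"
    unfolding eq using integrable_noise_simps(4)[of 2] integrable_noise_simps(5) by simp
  have "(\<integral>x. (U x - quad_risk \<theta> js_est)\<^sup>2 \<partial>gauss \<theta> 1) = (n - 2) ^ 4 * (inv_moment 2 - (inv_moment 1)\<^sup>2)"
    unfolding eq using integrable_noise_simps(4)[of 2] integrable_noise_simps(5)
    by (simp add: inv_moment_def power2_eq_square)
  also have "\<dots> \<le> 18 / 5 * n"
  proof -
    have "(n - 4)\<^sup>2 * ((n - 2) ^ 4 * (inv_moment 2 - (inv_moment 1)\<^sup>2)) = (n - 2) ^ 4 * ((n - 4)\<^sup>2 * (inv_moment 2 - (inv_moment 1)\<^sup>2))"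
      by simp
    also have "\<dots> \<le> (n - 2) ^ 4 * (2 * n * (inv_moment 1)\<^sup>2)"
      using inv_sq_variance_le by (intro mult_left_mono) (auto simp: n_def)
    also have "\<dots> = 2 * n * (n - 2)\<^sup>2 * ((n - 2) * inv_moment 1)\<^sup>2"
      by algebra
    also have "\<dots> \<le> 2 * n * (n - 2)\<^sup>2 * 1\<^sup>2"
      using inv_moment_1_le inv_moment_nonneg[of 1] n
      by (intro mult_left_mono power_mono) (auto simp: n_def)
    also have "\<dots> \<le> (n - 4)\<^sup>2 * (18 / 5 * n)"
    proof -
      \<comment> \<open>The polynomial 18 (n - 4)^2 - 10 (n - 2)^2, divided by n - 10 with
        remainder.\<close>
      have "0 \<le> (n - 10) * (8 * n - 24) + 8"
        using n by (intro add_nonneg_nonneg mult_nonneg_nonneg) auto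
      then have "10 * (n - 2)\<^sup>2 \<le> 18 * (n - 4)\<^sup>2"
        using n by (simp add: power2_eq_square algebra_simps)
      then have "n * (10 * (n - 2)\<^sup>2) \<le> n * (18 * (n - 4)\<^sup>2)"
        using n by (intro mult_left_mono) auto
      then show ?thesis by simp
    qed
    finally show ?thesis
      using n by (subst (asm) mult_le_cancel_left_pos) auto
  qed
  finally show "(\<integral>x. (U x - quad_risk \<theta> js_est)\<^sup>2 \<partial>gauss \<theta> 1) \<le> 18 / 5 * real CARD('n)"
    by (simp add: n_def)
qed

text \<open>The loss is \<open>U\<close> plus \<open>loss_gap\<close>. Bounding (a + b)^2 by 2 a^2 +
  2 b^2 avoids their covariance and gives 2 (18/5 + 21/5) = 78/5.\<close>

lemma js_loss_variance:
  shows "integrable (gauss \<theta> 1) (\<lambda>x. ((norm (js_est x - \<theta>))\<^sup>2 - quad_risk \<theta> js_est)\<^sup>2)"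
    and "(\<integral>x. ((norm (js_est x - \<theta>))\<^sup>2 - quad_risk \<theta> js_est)\<^sup>2 \<partial>gauss \<theta> 1) \<le> 78 / 5 * real CARD('n)"
proof -
  define V where "V x = real CARD('n) - (real CARD('n) - 2)\<^sup>2 * inv_sq x - quad_risk \<theta> js_est" for x :: "real ^ 'n"
  have [measurable]: "V \<in> borel_measurable borel" "loss_gap \<in> borel_measurable borel"
    unfolding V_def[abs_def] loss_gap_def[abs_def] by measurable
  have int: "integrable (gauss \<theta> 1) (\<lambda>x. 2 * (V x)\<^sup>2 + 2 * (loss_gap x)\<^sup>2)"
    using unbiased_risk_variance(1) integrable_loss_gap_sq by (simp add: V_def)
  have le: "(V x + loss_gap x)\<^sup>2 \<le> 2 * (V x)\<^sup>2 + 2 * (loss_gap x)\<^sup>2" for x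
    using zero_le_power2[of "V x - loss_gap x"] by (simp add: power2_eq_square algebra_simps)
  have eq: "((norm (js_est x - \<theta>))\<^sup>2 - quad_risk \<theta> js_est)\<^sup>2 = (V x + loss_gap x)\<^sup>2" for x
    unfolding js_loss_eq V_def by (simp add: algebra_simps)
  show int': "integrable (gauss \<theta> 1) (\<lambda>x. ((norm (js_est x - \<theta>))\<^sup>2 - quad_risk \<theta> js_est)\<^sup>2)"
    unfolding eq by (rule Bochner_Integration.integrable_bound[OF int]) (use le in auto)
  have "(\<integral>x. (V x + loss_gap x)\<^sup>2 \<partial>gauss \<theta> 1) \<le> (\<integral>x. 2 * (V x)\<^sup>2 + 2 * (loss_gap x)\<^sup>2 \<partial>gauss \<theta> 1)"
    using int' le unfolding eq by (intro integral_mono[OF _ int])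
  also have "\<dots> = 2 * (\<integral>x. (V x)\<^sup>2 \<partial>gauss \<theta> 1) + 2 * (\<integral>x. (loss_gap x)\<^sup>2 \<partial>gauss \<theta> 1)"
    using unbiased_risk_variance(1) integrable_loss_gap_sq by (simp add: V_def)
  also have "\<dots> \<le> 78 / 5 * real CARD('n)"
    using unbiased_risk_variance(2) expectation_loss_gap_sq_le by (simp add: V_def)
  finally show "(\<integral>x. ((norm (js_est x - \<theta>))\<^sup>2 - quad_risk \<theta> js_est)\<^sup>2 \<partial>gauss \<theta> 1) \<le> 78 / 5 * real CARD('n)"
    unfolding eq .
qed

end

subsection \<open>Divergence of Gaussian predictive densities\<close>

lemma ext_integral_ereal:
  assumes "integrable M f"
  shows "ext_integral M (\<lambda>x. ereal (f x)) = ereal (\<integral>x. f x \<partial>M)"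
proof -
  have "(\<integral>\<^sup>+x. ennreal (f x) \<partial>M) \<noteq> \<infinity>" "(\<integral>\<^sup>+x. ennreal (- f x) \<partial>M) \<noteq> \<infinity>"
    using integrableD(2)[OF assms] integrableD(3)[OF assms] by auto
  then obtain a b where ab: "0 \<le> a" "0 \<le> b"
    "(\<integral>\<^sup>+x. ennreal (f x) \<partial>M) = ennreal a" "(\<integral>\<^sup>+x. ennreal (- f x) \<partial>M) = ennreal b"
    by (metis ennreal_cases infinity_ennreal_def)
  have "e2ennreal (ereal t) = ennreal t" for t
    by (simp add: ennreal.abs_eq)
  then show ?thesis
    unfolding ext_integral_def real_lebesgue_integral_def[OF assms] using ab by simp
qed

text \<open>The function \<open>g\<close> may have an infinite integral, since the oracle bound must
  also cover scale estimates of infinite risk. As \<open>g\<close> is nonnegative, its negative part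
  contributes 0 and the difference in \<open>ext_integral\<close> is never ambiguous.\<close>

lemma ext_integral_mono_nonneg:
  assumes f: "integrable M f" "\<And>x. 0 \<le> f x" and le: "\<And>x. ereal (f x) \<le> g x"
  shows "ereal (\<integral>x. f x \<partial>M) \<le> ext_integral M g"
proof -
  have nonneg: "0 \<le> g x" for x
    using f(2)[of x] le[of x] by (metis ereal_less_eq(5) order_trans)
  have "- g x \<le> 0" for x
    using nonneg[of x] by simp
  then have neg: "e2ennreal (- g x) = 0" for x
    by (simp add: e2ennreal_neg)
  have "ereal (\<integral>x. f x \<partial>M) = enn2ereal (\<integral>\<^sup>+x. ennreal (f x) \<partial>M)"
    using f by (simp add: nn_integral_eq_integral)
  also have "\<dots> \<le> enn2ereal (\<integral>\<^sup>+x. e2ennreal (g x) \<partial>M)"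
  proof (subst less_eq_ennreal.rep_eq[symmetric], rule nn_integral_mono)
    fix x
    have "ennreal (f x) = e2ennreal (ereal (f x))"
      by (simp add: ennreal.abs_eq)
    also have "\<dots> \<le> e2ennreal (g x)"
      by (rule e2ennreal_mono[OF le])
    finally show "ennreal (f x) \<le> e2ennreal (g x)" .
  qed
  finally show ?thesis
    by (simp add: ext_integral_def neg zero_ennreal.rep_eq)
qed

lemma gauss_second_moment:
  fixes m a :: "real ^ 'n"
  assumes v: "0 < v" and dim: "2 \<le> CARD('n)"
  shows "integrable (gauss m v) (\<lambda>x. (norm (x - a))\<^sup>2)"
    and "(\<integral>x. (norm (x - a))\<^sup>2 \<partial>gauss m v) = v * real CARD('n) + (norm (m - a))\<^sup>2"
proof -
  interpret prob_space "gauss m v" by (rule prob_space_gauss[OF v])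
  have P [simp]: "measure (gauss m v) UNIV = 1"
    using prob_space by simp
  have pg: "pole_growth 0 (\<lambda>x::real^'n. (x - a) \<bullet> c)" "pole_growth 0 (\<lambda>x::real^'n. (x - a) \<bullet> (x - a))" for a c
  proof -
    have "pole_growth (max 0 0 + 0) (\<lambda>x::real^'n. (x - a) \<bullet> c)"
      "pole_growth (max 0 0 + max 0 0) (\<lambda>x::real^'n. (x - a) \<bullet> (x - a))"
      by (rule pole_growth_intros)+
    then show "pole_growth 0 (\<lambda>x::real^'n. (x - a) \<bullet> c)" "pole_growth 0 (\<lambda>x::real^'n. (x - a) \<bullet> (x - a))"
      by simp_all
  qed
  note int = integrable_gauss_pole_growth_0[OF v pg(1)] integrable_gauss_pole_growth_0[OF v pg(2)]
  show "integrable (gauss m v) (\<lambda>x. (norm (x - a))\<^sup>2)"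
    unfolding power2_norm_eq_inner by (rule int)
  have stein: "(\<integral>x. (x - m) \<bullet> (\<alpha> *\<^sub>R x + c) \<partial>gauss m v) = v * (\<alpha> * real CARD('n))" for \<alpha> c
  proof -
    have sq: "integrable (gauss m v) (\<lambda>x. (1 + norm x)\<^sup>2)"
      by (rule integrable_gauss_norm_power[OF v])
    have "((\<lambda>x. 1) has_derivative (\<bullet>) ((\<lambda>x. 0) x)) (at x)" for x :: "real ^ 'n"
      by (rule has_derivative_eq_rhs[OF has_derivative_const]) (simp add: fun_eq_iff)
    from stein_field[OF v dim this, of m \<alpha> c] sq show ?thesis
      by simp
  qed
  define d where "d = (norm (m - a))\<^sup>2"
  \<comment> \<open>The square is expanded about m, with both nonconstant terms written as x - m
    paired with an affine field, so that Stein's identity with \<open>h\<close> = 1 evaluates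
    them.\<close>
  have eq: "(norm (x - a))\<^sup>2 = (x - m) \<bullet> (1 *\<^sub>R x + - m) + 2 * ((x - m) \<bullet> (0 *\<^sub>R x + (m - a))) + d" for x
    unfolding d_def power2_norm_eq_inner by (simp add: algebra_simps inner_commute)
  show "(\<integral>x. (norm (x - a))\<^sup>2 \<partial>gauss m v) = v * real CARD('n) + (norm (m - a))\<^sup>2"
  proof -
    have "(\<integral>x. (norm (x - a))\<^sup>2 \<partial>gauss m v) = (\<integral>x. (x - m) \<bullet> (1 *\<^sub>R x + - m) \<partial>gauss m v)
        + 2 * (\<integral>x. (x - m) \<bullet> (0 *\<^sub>R x + (m - a)) \<partial>gauss m v) + d"
      unfolding eq using int by simp
    then show ?thesis
      unfolding stein d_def by simp
  qed
qed

text \<open>Both densities are positive, so the conventional cases of \<open>KL_density\<close> do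
  not arise. The log ratio \<open>l\<close> is a difference of two quadratics, whose means are given
  by the second moments about \<theta> and about \<mu>.\<close>

lemma KL_density_gauss:
  fixes \<theta> \<mu> :: "real ^ 'n"
  assumes r: "0 < r" and c: "0 < c" and dim: "2 \<le> CARD('n)"
  shows "KL_density (gauss_density \<theta> r) (gauss_density \<mu> (c * r))
       = ereal (real CARD('n) / 2 * (ln c - 1 + (1 + (norm (\<mu> - \<theta>))\<^sup>2 / (real CARD('n) * r)) / c))"
proof -
  let ?n = "real CARD('n)"
  interpret prob_space "gauss \<theta> r" by (rule prob_space_gauss[OF r])
  have P [simp]: "measure (gauss \<theta> r) UNIV = 1"
    using prob_space by simp
  have cr: "0 < c * r" using r c by simp
  define l where "l y = ?n / 2 * ln c - (norm (y - \<theta>))\<^sup>2 / (2 * r) + (norm (y - \<mu>))\<^sup>2 / (2 * (c * r))" for y :: "real ^ 'n"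
  have [measurable]: "l \<in> borel_measurable borel"
    unfolding l_def[abs_def] by measurable
  have ln_ratio: "ln (gauss_density \<theta> r y / gauss_density \<mu> (c * r) y) = l y" for y
  proof -
    have ln_gauss: "ln (gauss_density m v y) = - ?n / 2 * ln (2 * pi * v) - (norm (y - m))\<^sup>2 / (2 * v)"
      if "0 < v" for m :: "real ^ 'n" and v
      using that unfolding gauss_density_eq[OF that]
      by (simp add: ln_mult ln_realpow ln_div ln_sqrt)
    have "ln (2 * pi * (c * r)) = ln c + ln (2 * pi * r)"
      using r c by (simp add: ln_mult)
    moreover have "ln (gauss_density \<theta> r y / gauss_density \<mu> (c * r) y)
        = ln (gauss_density \<theta> r y) - ln (gauss_density \<mu> (c * r) y)"
      using gauss_density_pos[OF r, of \<theta> y] gauss_density_pos[OF cr, of \<mu> y] by (simp add: ln_div)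
    ultimately show ?thesis
      unfolding l_def ln_gauss[OF r] ln_gauss[OF cr] by (simp add: algebra_simps)
  qed
  have int_l: "integrable (gauss \<theta> r) l"
    unfolding l_def[abs_def] using gauss_second_moment(1)[OF r dim] by simp
  have "KL_density (gauss_density \<theta> r) (gauss_density \<mu> (c * r))
      = ext_integral lborel (\<lambda>y. ereal (gauss_density \<theta> r y * l y))"
  proof -
    have "gauss_density \<theta> r y \<noteq> 0" "gauss_density \<mu> (c * r) y \<noteq> 0" for y
      using gauss_density_pos[OF r, of \<theta> y] gauss_density_pos[OF cr, of \<mu> y] by simp_all
    then show ?thesis
      unfolding KL_density_def ln_ratio by simp
  qed
  also have "\<dots> = ereal (\<integral>y. gauss_density \<theta> r y * l y \<partial>lborel)"
    using int_l by (intro ext_integral_ereal) (simp add: integrable_gauss_iff)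
  also have "(\<integral>y. gauss_density \<theta> r y * l y \<partial>lborel) = (\<integral>y. l y \<partial>gauss \<theta> r)"
    by (simp add: integral_gauss)
  also have "\<dots> = ?n / 2 * ln c - (r * ?n) / (2 * r) + (r * ?n + (norm (\<theta> - \<mu>))\<^sup>2) / (2 * (c * r))"
    unfolding l_def using gauss_second_moment[OF r dim, of \<theta>] by simp
  also have "\<dots> = ?n / 2 * (ln c - 1 + (1 + (norm (\<mu> - \<theta>))\<^sup>2 / (?n * r)) / c)"
    using r c by (simp add: norm_minus_commute field_simps)
  finally show ?thesis .
qed

lemma pred_risk_g_est:
  fixes \<theta> :: "real ^ 'n"
  assumes "0 < r" "2 \<le> CARD('n)" "\<And>x. 0 < chat x"
  shows "pred_risk r \<theta> (g_est r \<theta>hat chat) = ext_integral (gauss \<theta> 1) (\<lambda>x.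
     ereal (real CARD('n) / 2 * (ln (chat x) - 1 + (1 + (norm (\<theta>hat x - \<theta>))\<^sup>2 / (real CARD('n) * r)) / chat x)))"
  unfolding pred_risk_def g_est_def using assms by (simp add: KL_density_gauss)

text \<open>Pointwise in \<open>x\<close>, the best scale is \<open>A = 1 + loss / (n r)\<close>, with divergence \<open>n / 2 ln A\<close>.\<close>

lemma oracle_risk_ge:
  fixes r :: real and \<theta> :: "real ^ 'n" and \<theta>hat :: "real ^ 'n \<Rightarrow> real ^ 'n"
  defines "A \<equiv> \<lambda>x. 1 + (norm (\<theta>hat x - \<theta>))\<^sup>2 / (real CARD('n) * r)"
  assumes r: "0 < r" and dim: "2 \<le> CARD('n)"
    and int: "integrable (gauss \<theta> 1) (\<lambda>x. ln (A x))"
  shows "ereal (real CARD('n) / 2 * (\<integral>x. ln (A x) \<partial>gauss \<theta> 1)) \<le> oracle_risk r \<theta> \<theta>hat"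
  unfolding oracle_risk_def
proof (rule INF_greatest)
  fix chat :: "real ^ 'n \<Rightarrow> real"
  assume "chat \<in> {chat. chat \<in> borel_measurable borel \<and> (\<forall>x. 0 < chat x)}"
  then have c: "0 < chat x" for x by simp
  \<comment> \<open>This makes \<open>ln (A x)\<close> nonnegative, as
    \<open>ext_integral_mono_nonneg\<close> demands of the lower function.\<close>
  have A: "1 \<le> A x" for x
    using r by (simp add: A_def)
  have "ln (A x) \<le> ln (chat x) - 1 + A x / chat x" for x
  proof -
    have pos: "0 < A x" using A[of x] by linarith
    have "ln (A x) - ln (chat x) = ln (A x / chat x)"
      using pos c[of x] by (simp add: ln_div)
    also have "\<dots> \<le> A x / chat x - 1"
      using pos c[of x] by (intro ln_le_minus_one) simp
    finally show ?thesis by simp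
  qed
  then have "ereal (\<integral>x. real CARD('n) / 2 * ln (A x) \<partial>gauss \<theta> 1)
      \<le> ext_integral (gauss \<theta> 1) (\<lambda>x. ereal (real CARD('n) / 2 * (ln (chat x) - 1 + A x / chat x)))"
    using int A by (intro ext_integral_mono_nonneg) (auto intro!: mult_left_mono)
  also have "\<dots> = pred_risk r \<theta> (g_est r \<theta>hat chat)"
    using r dim c by (simp add: pred_risk_g_est A_def)
  finally show "ereal (real CARD('n) / 2 * (\<integral>x. ln (A x) \<partial>gauss \<theta> 1)) \<le> \<dots>"
    by simp
qed

text \<open>Since f is the mean of \<open>A\<close>, the term (A - f) / f has mean 0 and can be
  subtracted. The remainder \<open>E\<close> is a divergence between c and f, at most quadratic in c
  - f, plus the product of A - f with 1 / c - 1 / f. All denominators are at least 1, so the error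
  is of second order in the two deviations.\<close>

lemma (in prob_space) plug_in_scale_risk:
  fixes c A :: "'a \<Rightarrow> real"
  assumes c: "integrable M c" "\<And>x. 1 \<le> c x" and A: "integrable M A" "\<And>x. 1 \<le> A x"
    and f: "f = expectation A"
    and cf: "integrable M (\<lambda>x. (c x - f)\<^sup>2)" and Af: "integrable M (\<lambda>x. (A x - f)\<^sup>2)"
  shows "integrable M (\<lambda>x. ln (A x))"
    and "integrable M (\<lambda>x. ln (c x) - 1 + A x / c x)"
    and "\<bar>expectation (\<lambda>x. ln (c x) - 1 + A x / c x) - ln f\<bar>
        \<le> (3 * expectation (\<lambda>x. (c x - f)\<^sup>2) + expectation (\<lambda>x. (A x - f)\<^sup>2)) / 2"
    and "ln f - expectation (\<lambda>x. ln (A x)) \<le> expectation (\<lambda>x. (A x - f)\<^sup>2)"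
proof -
  have [measurable]: "c \<in> borel_measurable M" "A \<in> borel_measurable M"
    using c A by auto
  have f1: "1 \<le> f"
    unfolding f using A by (intro integral_ge_const) auto
  have ln_int: "integrable M (\<lambda>x. ln (h x))" if h: "integrable M h" "\<And>x. 1 \<le> h x" for h :: "'a \<Rightarrow> real"
  proof (rule Bochner_Integration.integrable_bound[OF h(1)])
    show "(\<lambda>x. ln (h x)) \<in> borel_measurable M"
      using h(1) by auto
    show "AE x in M. norm (ln (h x)) \<le> norm (h x)"
    proof (rule AE_I2)
      fix x
      have "1 \<le> h x" "ln (h x) \<le> h x - 1"
        using h(2)[of x] ln_le_minus_one[of "h x"] by auto
      then show "norm (ln (h x)) \<le> norm (h x)" by simp
    qed
  qed
  show lnA: "integrable M (\<lambda>x. ln (A x))" by (rule ln_int[OF A])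
  have Ac: "integrable M (\<lambda>x. A x / c x)"
  proof (rule Bochner_Integration.integrable_bound[OF A(1)])
    show "AE x in M. norm (A x / c x) \<le> norm (A x)"
    proof (rule AE_I2)
      fix x
      show "norm (A x / c x) \<le> norm (A x)"
        using A(2)[of x] c(2)[of x] by (simp add: divide_le_eq mult_le_cancel_left1)
    qed
  qed measurable
  show R: "integrable M (\<lambda>x. ln (c x) - 1 + A x / c x)"
    using Ac ln_int[OF c] by simp
  \<comment> \<open>The Itakura-Saito divergence t / s - ln (t / s) - 1. Applying ln y \<le> y - 1
    to t / s gives the lower bound, to s / t the upper one.\<close>
  have ratio: "0 \<le> ln s - ln t - 1 + t / s" "ln s - ln t - 1 + t / s \<le> (s - t)\<^sup>2"
    if st: "1 \<le> s" "1 \<le> t" for s t :: real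
  proof -
    have pos: "0 < s" "0 < t" using st by auto
    have "ln (t / s) \<le> t / s - 1" "ln (s / t) \<le> s / t - 1"
      using pos by (auto intro!: ln_le_minus_one)
    then have *: "ln t - ln s \<le> t / s - 1" "ln s - ln t \<le> s / t - 1"
      using pos by (simp_all add: ln_div)
    from *(1) show "0 \<le> ln s - ln t - 1 + t / s" by simp
    have "ln s - ln t - 1 + t / s \<le> s / t - 2 + t / s"
      using *(2) by simp
    also have "\<dots> = (s - t)\<^sup>2 / (s * t)"
      using pos by (simp add: field_simps power2_eq_square)
    also have "\<dots> \<le> (s - t)\<^sup>2 / 1"
      using st mult_mono[of 1 s 1 t] by (intro divide_left_mono) auto
    finally show "ln s - ln t - 1 + t / s \<le> (s - t)\<^sup>2" by simp
  qed
  have cross: "\<bar>(A x - f) / c x - (A x - f) / f\<bar> \<le> ((c x - f)\<^sup>2 + (A x - f)\<^sup>2) / 2" for x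
  proof -
    have pos: "0 < c x" "0 < f" using c(2)[of x] f1 by auto
    have "(A x - f) / c x - (A x - f) / f = (A x - f) * (f - c x) / (c x * f)"
      using pos by (simp add: field_simps)
    then have "\<bar>(A x - f) / c x - (A x - f) / f\<bar> = \<bar>(A x - f) * (f - c x)\<bar> / (c x * f)"
      using pos by (simp add: abs_divide abs_mult)
    also have "\<dots> \<le> \<bar>(A x - f) * (f - c x)\<bar> / 1"
      using c(2)[of x] f1 mult_mono[of 1 "c x" 1 f] by (intro divide_left_mono) auto
    also have "\<dots> \<le> ((c x - f)\<^sup>2 + (A x - f)\<^sup>2) / 2"
      using zero_le_power2[of "A x - f + (f - c x)"] zero_le_power2[of "A x - f - (f - c x)"]
      unfolding abs_le_iff div_by_1 by (simp add: power2_eq_square algebra_simps)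
    finally show ?thesis .
  qed
  have lin: "integrable M (\<lambda>x. (A x - f) / f)" "expectation (\<lambda>x. (A x - f) / f) = 0"
    using A(1) by (simp_all add: f prob_space)
  define E where "E x = ln (c x) - 1 + A x / c x - ln f - (A x - f) / f" for x
  have E_int: "integrable M E"
    unfolding E_def using R lin(1) by simp
  have E_exp: "expectation E = expectation (\<lambda>x. ln (c x) - 1 + A x / c x) - ln f"
    unfolding E_def using R lin by (simp add: prob_space)
  have E_eq: "E x = (ln (c x) - ln f - 1 + f / c x) + ((A x - f) / c x - (A x - f) / f)" for x
    unfolding E_def by (simp add: diff_divide_distrib)
  have cross': "(A x - f) / c x - (A x - f) / f \<le> ((c x - f)\<^sup>2 + (A x - f)\<^sup>2) / 2"
    "- ((A x - f) / c x - (A x - f) / f) \<le> ((c x - f)\<^sup>2 + (A x - f)\<^sup>2) / 2" for x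
    using cross[of x] by (simp_all only: abs_le_iff)
  have sum_le: "s + t \<le> (3 * a + b) / 2" if "s \<le> a" "t \<le> (a + b) / 2" for s t a b :: real
    using that by simp
  have neg_sum_le: "- (s + t) \<le> (3 * a + b) / 2" if "0 \<le> s" "0 \<le> a" "- t \<le> (a + b) / 2" for s t a b :: real
    using that by (simp add: field_simps)
  have upper: "E x \<le> (3 * (c x - f)\<^sup>2 + (A x - f)\<^sup>2) / 2" for x
    unfolding E_eq by (rule sum_le[OF ratio(2)[OF c(2) f1] cross'(1)])
  have lower: "- E x \<le> (3 * (c x - f)\<^sup>2 + (A x - f)\<^sup>2) / 2" for x
    unfolding E_eq by (rule neg_sum_le[OF ratio(1)[OF c(2) f1] zero_le_power2 cross'(2)])
  have "\<bar>expectation E\<bar> \<le> expectation (\<lambda>x. (3 * (c x - f)\<^sup>2 + (A x - f)\<^sup>2) / 2)"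
  proof (rule abs_leI)
    show "expectation E \<le> expectation (\<lambda>x. (3 * (c x - f)\<^sup>2 + (A x - f)\<^sup>2) / 2)"
      using E_int cf Af upper by (intro integral_mono) auto
    have "expectation (\<lambda>x. - E x) \<le> expectation (\<lambda>x. (3 * (c x - f)\<^sup>2 + (A x - f)\<^sup>2) / 2)"
      using E_int cf Af lower by (intro integral_mono) auto
    then show "- expectation E \<le> expectation (\<lambda>x. (3 * (c x - f)\<^sup>2 + (A x - f)\<^sup>2) / 2)"
      by simp
  qed
  then show "\<bar>expectation (\<lambda>x. ln (c x) - 1 + A x / c x) - ln f\<bar>
        \<le> (3 * expectation (\<lambda>x. (c x - f)\<^sup>2) + expectation (\<lambda>x. (A x - f)\<^sup>2)) / 2"
    unfolding E_exp using cf Af by simp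
  \<comment> \<open>The upper bound in \<open>ratio\<close> at s = f and t = \<open>A x\<close>. In
    the mean the linear term drops out, and what is left bounds the Jensen gap of ln at
    \<open>A\<close> from above.\<close>
  have jensen: "ln f - ln (A x) + (A x - f) / f \<le> (A x - f)\<^sup>2" for x
    using ratio(2)[OF f1 A(2)[of x]] f1 ratio(2)[OF A(2)[of x] f1] ratio(1)[OF f1 A(2)[of x]]
    by (simp add: diff_divide_distrib power2_commute)
  have "expectation (\<lambda>x. ln f - ln (A x) + (A x - f) / f) \<le> expectation (\<lambda>x. (A x - f)\<^sup>2)"
    using lnA lin(1) Af jensen by (intro integral_mono) auto
  then show "ln f - expectation (\<lambda>x. ln (A x)) \<le> expectation (\<lambda>x. (A x - f)\<^sup>2)"
    using lnA lin f1 by (auto simp: prob_space)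
qed

subsection \<open>Risk of the plug-in scale\<close>

lemma one_le_power_int_minus_2:
  fixes x :: real
  assumes "0 < x" "x \<le> 1"
  shows "1 \<le> x powi (-2)"
proof -
  have "x\<^sup>2 \<le> 1" using assms by (simp add: power_le_one)
  then show ?thesis
    using assms by (simp add: power_int_minus one_le_inverse)
qed

lemma a_const_ge: "10 \<le> n \<Longrightarrow> 3 \<le> a_const n"
  using one_le_power_int_minus_2[of "1 - (real n - 2) powi (-1)"]
  by (simp add: a_const_def power_int_minus inverse_less_1_iff)

lemma l_const_ge: "10 \<le> n \<Longrightarrow> 3 \<le> l_const n"
  using one_le_power_int_minus_2[of "1 - 2 / real n"]
  by (simp add: l_const_def)

text \<open>24 = 4 (2 + 3 + 1): the last summand comes from \<open>k2_const n\<close> \<ge>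
  \<open>e_const n\<close> \<ge> 1, because the product P lies between 0 and 1 and is raised to a
  negative power. Its smallest factor 1 - 9 / n is positive for n \<ge> 10.\<close>

lemma b_const_ge:
  assumes n: "10 \<le> n"
  shows "24 \<le> b_const n"
proof -
  define P where "P = (\<Prod>i\<in>{1..4::nat}. 1 - (2 * real i + 1) / real n)"
  have P: "0 < P" "P \<le> 1"
    unfolding P_def using n by (auto intro!: prod_pos prod_le_1 simp: divide_simps)
  have "1 \<le> P powr (- 1 / 2)"
    using powr_mono'[of "- 1 / 2" 0 P] P by simp
  moreover have "1 \<le> sqrt 3"
    by simp
  ultimately have "1 * 1 \<le> sqrt 3 * P powr (- 1 / 2)"
    by (intro mult_mono) auto
  then have "1 \<le> k2_const n"
    by (simp add: k2_const_def e_const_def P_def)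
  with a_const_ge[OF n] show ?thesis
    by (simp add: b_const_def)
qed

text \<open>The coefficient 66/5 is (3 * 18/5 + 78/5) / 2 from \<open>plug_in_scale_risk\<close>.
  The comparison with the oracle adds the Jensen gap 78/5, which makes 144/5.\<close>

lemma js_risk_bounds:
  fixes r :: real and \<theta> :: "real ^ 'n"
  assumes r: "0 < r" and dim: "10 \<le> CARD('n)"
  shows "pred_risk r \<theta> (g_js r) - oracle_risk r \<theta> js_est \<le> ereal (1 / 2 * (144 / 5 * r powi (-2)))"
    and "\<bar>pred_risk r \<theta> (g_js r) - ereal (real CARD('n) / 2 * ln (ideal_flat r \<theta> js_est))\<bar>
       \<le> ereal (1 / 2 * (66 / 5 * r powi (-2)))"
proof -
  define n where "n = real CARD('n)"
  define q where "q = quad_risk \<theta> js_est"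
  define L where "L x = (norm (js_est x - \<theta>))\<^sup>2" for x :: "real ^ 'n"
  define U where "U x = n - (n - 2)\<^sup>2 * inv_sq x" for x :: "real ^ 'n"
  define A where "A x = 1 + L x / (n * r)" for x
  define f where "f = ideal_flat r \<theta> js_est"
  let ?c = "js_scale r :: real ^ 'n \<Rightarrow> real" and ?M = "gauss \<theta> 1"
  interpret prob_space ?M by (rule prob_space_gauss) simp
  have P [simp]: "measure ?M UNIV = 1"
    using prob_space by simp
  have n: "10 \<le> n" using dim by (simp add: n_def)
  have nr: "0 < n * r" using n r by simp
  have dim2: "2 \<le> CARD('n)" using dim by simp
  have L_int: "integrable ?M L"
    unfolding L_def using integrable_js_loss[OF dim] .
  have q0: "0 \<le> q"
    unfolding q_def quad_risk_def by simp
  have f_eq: "f = 1 + q / (n * r)"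
    by (simp add: f_def ideal_flat_def n_def q_def)
  have Up: "U_plus x = max (U x) 0" for x :: "real ^ 'n"
    by (simp add: U_plus_def U_def inv_sq_def n_def)
  have Up_bounds: "0 \<le> U_plus x" "U_plus x \<le> n" for x :: "real ^ 'n"
    unfolding Up U_def using n by auto
  have [measurable]: "U \<in> borel_measurable borel"
    unfolding U_def[abs_def] by measurable
  have c_meas [measurable]: "?c \<in> borel_measurable borel"
    unfolding js_scale_def[abs_def] Up by measurable
  have c1: "1 \<le> ?c x" for x
    using Up_bounds(1)[of x] r by (simp add: js_scale_def)
  have c_int: "integrable ?M ?c"
  proof (rule integrable_const_bound)
    show "AE x in ?M. norm (?c x) \<le> 1 + n / (n * r)"
    proof (rule AE_I2)
      fix x
      have "?c x \<le> 1 + n / (n * r)"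
        unfolding js_scale_def n_def[symmetric] using Up_bounds(2)[of x] nr
        by (intro add_left_mono divide_right_mono) auto
      then show "norm (?c x) \<le> 1 + n / (n * r)"
        using c1[of x] by simp
    qed
  qed simp
  have A1: "1 \<le> A x" for x
    using nr by (simp add: A_def L_def)
  have A_int: "integrable ?M A"
    unfolding A_def[abs_def] using L_int by simp
  have f_exp: "f = expectation A"
  proof -
    have "expectation A = 1 + expectation L / (n * r)"
      unfolding A_def[abs_def] using L_int by simp
    then show ?thesis
      unfolding f_eq q_def quad_risk_def L_def[abs_def] by simp
  qed
  note var_U = unbiased_risk_variance[OF dim, of \<theta>, folded n_def q_def, folded U_def]
  note var_L = js_loss_variance[OF dim, of \<theta>, folded n_def q_def, folded L_def]
  \<comment> \<open>Since the true risk \<open>q\<close> is nonnegative, taking the positive part of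
    \<open>U\<close> can only move it closer to \<open>q\<close>.\<close>
  have cf_le: "(?c x - f)\<^sup>2 \<le> (U x - q)\<^sup>2 / (n * r)\<^sup>2" for x
  proof -
    have "\<bar>U_plus x - q\<bar> \<le> \<bar>U x - q\<bar>"
      unfolding Up using q0 by (auto simp: max_def)
    then have "(U_plus x - q)\<^sup>2 \<le> (U x - q)\<^sup>2"
      by (simp add: abs_le_square_iff)
    moreover have "?c x - f = (U_plus x - q) / (n * r)"
      by (simp add: js_scale_def f_eq n_def diff_divide_distrib)
    ultimately show ?thesis
      by (simp add: power_divide divide_right_mono)
  qed
  have Udiv: "integrable ?M (\<lambda>x. (U x - q)\<^sup>2 / (n * r)\<^sup>2)"
    using var_U(1) by simp
  have cf_int: "integrable ?M (\<lambda>x. (?c x - f)\<^sup>2)"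
    by (rule Bochner_Integration.integrable_bound[OF Udiv]) (use cf_le in auto)
  have Af_eq: "(A x - f)\<^sup>2 = (L x - q)\<^sup>2 / (n * r)\<^sup>2" for x
    by (simp add: A_def f_eq flip: diff_divide_distrib power_divide)
  have Af_int: "integrable ?M (\<lambda>x. (A x - f)\<^sup>2)"
    unfolding Af_eq using var_L(1) by simp
  \<comment> \<open>A variance t n of the loss or of its estimate becomes t K on the scale of the
    flattening coefficients; the factor n of the divergence then cancels the 1 / n in K, leaving a
    bound free of the dimension.\<close>
  define K where "K = r powi (-2) / n"
  have nK: "n * K = r powi (-2)"
    using n by (simp add: K_def)
  have scale: "t * n / (n * r)\<^sup>2 = t * K" for t
    using n r by (simp add: K_def power_int_minus divide_simps power2_eq_square)
  have "expectation (\<lambda>x. (?c x - f)\<^sup>2) \<le> expectation (\<lambda>x. (U x - q)\<^sup>2 / (n * r)\<^sup>2)"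
    using cf_int Udiv cf_le by (rule integral_mono)
  also have "\<dots> \<le> (18 / 5 * n) / (n * r)\<^sup>2"
    using divide_right_mono[OF var_U(2), of "(n * r)\<^sup>2"] by simp
  finally have v: "expectation (\<lambda>x. (?c x - f)\<^sup>2) \<le> 18 / 5 * K"
    unfolding scale .
  have "expectation (\<lambda>x. (A x - f)\<^sup>2) \<le> (78 / 5 * n) / (n * r)\<^sup>2"
    unfolding Af_eq using divide_right_mono[OF var_L(2), of "(n * r)\<^sup>2"] by simp
  then have w: "expectation (\<lambda>x. (A x - f)\<^sup>2) \<le> 78 / 5 * K"
    unfolding scale .
  note plug = plug_in_scale_risk[OF c_int c1 A_int A1 f_exp cf_int Af_int]
  define R where "R = expectation (\<lambda>x. ln (?c x) - 1 + A x / ?c x)"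
  have risk: "pred_risk r \<theta> (g_js r) = ereal (n / 2 * R)"
  proof -
    have "pred_risk r \<theta> (g_js r)
        = ext_integral ?M (\<lambda>x. ereal (n / 2 * (ln (?c x) - 1 + A x / ?c x)))"
      unfolding g_js_def A_def L_def n_def using r dim2 c1
      by (intro pred_risk_g_est) (auto intro: less_le_trans[OF zero_less_one])
    also have "\<dots> = ereal (n / 2 * R)"
      using plug(2) by (subst ext_integral_ereal) (auto simp: R_def)
    finally show ?thesis .
  qed
  have oracle_ge: "ereal (n / 2 * expectation (\<lambda>x. ln (A x))) \<le> oracle_risk r \<theta> js_est"
    using oracle_risk_ge[OF r dim2, of \<theta> js_est] plug(1) by (simp add: A_def L_def n_def)
  have half_n: "n / 2 * t \<le> 1 / 2 * (s * r powi (-2))" if "t \<le> s * K" for s t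
    using mult_left_mono[OF that, of "n / 2"] n nK by (simp add: mult.left_commute[of n])
  have gap: "\<bar>R - ln f\<bar> \<le> 66 / 5 * K"
    using plug(3) v w unfolding R_def[symmetric] by simp
  have "n / 2 * \<bar>R - ln f\<bar> \<le> 1 / 2 * (66 / 5 * r powi (-2))"
    using gap by (rule half_n)
  then show "\<bar>pred_risk r \<theta> (g_js r) - ereal (real CARD('n) / 2 * ln (ideal_flat r \<theta> js_est))\<bar>
       \<le> ereal (1 / 2 * (66 / 5 * r powi (-2)))"
    using n unfolding risk n_def[symmetric] f_def[symmetric]
    by (simp add: abs_mult flip: right_diff_distrib diff_divide_distrib)
  have "R - expectation (\<lambda>x. ln (A x)) \<le> 144 / 5 * K"
    using gap plug(4) w unfolding abs_le_iff by simp
  then have le: "n / 2 * R - n / 2 * expectation (\<lambda>x. ln (A x)) \<le> 1 / 2 * (144 / 5 * r powi (-2))"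
    unfolding right_diff_distrib[symmetric] by (rule half_n)
  have "pred_risk r \<theta> (g_js r) - oracle_risk r \<theta> js_est
      \<le> ereal (n / 2 * R) - ereal (n / 2 * expectation (\<lambda>x. ln (A x)))"
    unfolding risk by (rule ereal_minus_mono[OF order_refl oracle_ge])
  also have "\<dots> \<le> ereal (1 / 2 * (144 / 5 * r powi (-2)))"
    using le by (simp only: ereal_minus ereal_less_eq)
  finally show "pred_risk r \<theta> (g_js r) - oracle_risk r \<theta> js_est \<le> ereal (1 / 2 * (144 / 5 * r powi (-2)))" .
qed

theorem theorem1p2:
  fixes r :: real and \<theta> :: "real ^ 'n" and n :: nat
  assumes "0 < r" and "n = CARD('n)" and "10 \<le> n"
  shows "pred_risk r \<theta> (g_js r) - oracle_risk r \<theta> js_est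
           \<le> ereal (1/2 * (sqrt (a_const n) * sqrt (b_const n) * r powr (-3/2)
                + (a_const n + b_const n + l_const n) * r powi (-2)
                + a_const n * r powi (-3)))
       \<and> \<bar>pred_risk r \<theta> (g_js r) - ereal (real n / 2 * ln (ideal_flat r \<theta> js_est))\<bar>
           \<le> ereal (1/2 * (sqrt (a_const n) * sqrt (b_const n) * r powr (-3/2)
                + (a_const n + b_const n) * r powi (-2)
                + a_const n * r powi (-3)))"
proof -
  have dim: "10 \<le> CARD('n)" using assms by simp
  note const_bounds = a_const_ge[OF assms(3)] b_const_ge[OF assms(3)] l_const_ge[OF assms(3)]
  have mono: "ereal (1 / 2 * (s * r powi (-2)))
      \<le> ereal (1/2 * (sqrt (a_const n) * sqrt (b_const n) * r powr (-3/2)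
                + t * r powi (-2) + a_const n * r powi (-3)))" if "s \<le> t" for s t
  proof -
    have "0 \<le> sqrt (a_const n) * sqrt (b_const n) * r powr (-3/2)" "0 \<le> a_const n * r powi (-3)"
      using const_bounds assms(1) by (auto intro!: mult_nonneg_nonneg)
    moreover have "s * r powi (-2) \<le> t * r powi (-2)"
      using that assms(1) by (intro mult_right_mono) auto
    ultimately show ?thesis by simp
  qed
  \<comment> \<open>The bounds 3, 24 and 3 for a, b and l give 30 and 27 on the right.\<close>
  have "(144 / 5 :: real) \<le> a_const n + b_const n + l_const n" "(66 / 5 :: real) \<le> a_const n + b_const n"
    using const_bounds by simp_all
  from this[THEN mono] show ?thesis
    using js_risk_bounds[OF assms(1) dim, of \<theta>] unfolding assms(2)[symmetric]
    by (blast intro: order_trans)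
qed

end
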